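(* Let $\gamma\subset \partial_\infty\mathbb{H}^2\times\mathbb{R}$ be an arc. Assume there exist a vertical straight line $L\subset\partial_\infty\mathbb{H}^2\times\mathbb{R}$ and a subarc $\gamma'\subset\gamma$ such that (1) $\gamma'\cap L\neq\emptyset$ and $\partial\gamma'\cap L=\emptyset$ (where $\partial\gamma'$ is the set of end points of $\gamma'$); (2) $\gamma'$ stays on one side of $L$; (3) $\gamma'\subset\partial_\infty\mathbb{H}^2\times(t_0,\pi+t_0)$ for some real number $t_0$. Then there is no properly immersed minimal surface $M\subset\mathbb{H}^2\times\mathbb{R}$ (possibly with finite boundary) with asymptotic boundary $\gamma$ and such that $M\cup\gamma$ is a continuous surface with boundary.
   Context: $\mathbb{H}^2$ is the hyperbolic plane (curvature $-1$), $\mathbb{H}^2\times\mathbb{R}$ has the product metric. In the Poincaré disk model, $\overline{\mathbb{H}^2}=\mathbb{H}^2\cup\partial_\infty\mathbb{H}^2$ is the closed unit disk with its Euclidean topology, and $\partial_\infty\mathbb{H}^2\times\mathbb{R}$ is the asymptotic boundary considered for $\mathbb{H}^2\times\mathbb{R}$. The asymptotic boundary $\partial_\infty M$ of a surface $M\subset\mathbb{H}^2\times\mathbb{R}$ is the set of points of $\partial_\infty\mathbb{H}^2\times\mathbb{R}$ that are limits, in $\overline{\mathbb{H}^2}\times\mathbb{R}$, of sequences of points of $M$. The finite boundary of $M$ is its boundary $\partial M\subset\mathbb{H}^2\times\mathbb{R}$. "$M\cup\gamma$ is a continuous surface with boundary" means that $M\cup\gamma$, in $\overline{\mathbb{H}^2}\times\mathbb{R}$,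 is a topological surface with boundary, continuous up to $\gamma$, with $\gamma$ part of its boundary. A vertical straight line in $\partial_\infty\mathbb{H}^2\times\mathbb{R}$ is a set $L=\{q\}\times\mathbb{R}$ with $q\in\partial_\infty\mathbb{H}^2$. "$\gamma'$ stays on one side of $L=\{q\}\times\mathbb{R}$" means that the vertical projection of $\gamma'$ to $\partial_\infty\mathbb{H}^2$ is contained in a proper closed arc of the circle $\partial_\infty\mathbb{H}^2$ having $q$ as one of its two end points. *)

theory Defs
  imports "HOL-Analysis.Analysis"
begin

section \<open>The space \<open>H\<^sup>2 \<times> R\<close> and its asymptotic boundary\<close>

text \<open>The Poincare disk model is used: a point of \<open>H\<^sup>2 \<times> R\<close> is a pair \<open>(z, t)\<close> with \<open>|z| < 1\<close>.\<close>

definition H2R :: "(complex \<times> real) set"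
  where "H2R = ball 0 1 \<times> UNIV"

definition H2R_closed :: "(complex \<times> real) set"
  where "H2R_closed = cball 0 1 \<times> UNIV"

definition H2R_infinity :: "(complex \<times> real) set"
  where "H2R_infinity = sphere 0 1 \<times> UNIV"

definition vertical_line :: "complex \<Rightarrow> (complex \<times> real) set"
  where "vertical_line q = {q} \<times> UNIV"

definition asymptotic_boundary :: "(complex \<times> real) set \<Rightarrow> (complex \<times> real) set"
  where "asymptotic_boundary M =
    {p \<in> H2R_infinity. \<exists>s :: nat \<Rightarrow> complex \<times> real. (\<forall>n. s n \<in> M) \<and> s \<longlonglongrightarrow> p}"

definition one_side_of_vertical_line :: "complex \<Rightarrow> (complex \<times> real) set \<Rightarrow> bool"
  where "one_side_of_vertical_line q A \<longleftrightarrow>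
    (\<exists>c. arc c \<and> path_image c \<subset> sphere 0 1 \<and> q \<in> {pathstart c, pathfinish c} \<and>
         fst ` A \<subseteq> path_image c)"


section \<open>The product metric and its Levi-Civita connection\<close>

definition hyp_factor :: "complex \<Rightarrow> real"
  where "hyp_factor z = 2 / (1 - (norm z)\<^sup>2)"

definition H2R_metric :: "complex \<times> real \<Rightarrow> complex \<times> real \<Rightarrow> complex \<times> real \<Rightarrow> real"
  where "H2R_metric p v w = (hyp_factor (fst p))\<^sup>2 * (fst v \<bullet> fst w) + snd v * snd w"

text \<open>The Christoffel tensor \<open>\<Gamma>\<^sub>p(v, w)\<close> of the metric in the coordinates \<open>(z, t)\<close>: for constant
  fields \<open>v, w\<close> it is the covariant derivative of \<open>w\<close> in the direction \<open>v\<close>. On a conformal metric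
  \<open>\<lambda>\<^sup>2 |dz|\<^sup>2\<close> it is \<open>d(ln \<lambda>)(v) w + d(ln \<lambda>)(w) v - (v \<bullet> w) grad (ln \<lambda>)\<close>, and for
  \<open>\<lambda> = 2 / (1 - |z|\<^sup>2)\<close> the Euclidean gradient of \<open>ln \<lambda>\<close> is \<open>\<lambda> z\<close>. The two lemmas below
  (symmetry and compatibility with the metric) characterise the Levi-Civita connection.\<close>

definition H2R_christoffel ::
  "complex \<times> real \<Rightarrow> complex \<times> real \<Rightarrow> complex \<times> real \<Rightarrow> complex \<times> real"
  where "H2R_christoffel p v w =
    (hyp_factor (fst p) *\<^sub>R
       ((fst p \<bullet> fst v) *\<^sub>R fst w + (fst p \<bullet> fst w) *\<^sub>R fst v - (fst v \<bullet> fst w) *\<^sub>R fst p),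
     0)"

lemma H2R_christoffel_sym: "H2R_christoffel p v w = H2R_christoffel p w v"
  by (simp add: H2R_christoffel_def inner_commute algebra_simps)

lemma H2R_christoffel_metric:
  assumes "p \<in> H2R"
  shows "((\<lambda>p. H2R_metric p w x) has_derivative
          (\<lambda>v. H2R_metric p (H2R_christoffel p v w) x + H2R_metric p w (H2R_christoffel p v x))) (at p)"
proof -
  define D where "D = 1 - fst p \<bullet> fst p"
  have "norm (fst p) < 1"
    using assms by (auto simp: H2R_def)
  then have "(norm (fst p))\<^sup>2 < 1"
    by (simp add: power_less_one_iff abs_square_less_1)
  then have D: "D \<noteq> 0"
    by (simp add: D_def power2_norm_eq_inner)
  define f :: "complex \<times> real \<Rightarrow> real" where "f = (\<lambda>p. 1 - fst p \<bullet> fst p)"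
  have fp: "f p = D"
    by (simp add: f_def D_def)
  have f: "(f has_derivative (\<lambda>v. - 2 * (fst p \<bullet> fst v))) (at p)"
    unfolding f_def by (auto intro!: derivative_eq_intros simp: inner_commute)
  have "((\<lambda>p. (2 / f p)\<^sup>2 * (fst w \<bullet> fst x) + snd w * snd x) has_derivative
          (\<lambda>v. 2 * (2 / D) ^ 3 * (fst p \<bullet> fst v) * (fst w \<bullet> fst x))) (at p)"
    using D by (auto intro!: derivative_eq_intros f simp: fp fun_eq_iff)
      (simp add: field_simps power2_eq_square power3_eq_cube)
  then have H: "((\<lambda>p. (2 / (1 - fst p \<bullet> fst p))\<^sup>2 * (fst w \<bullet> fst x) + snd w * snd x) has_derivative
          (\<lambda>v. 2 * (2 / D) ^ 3 * (fst p \<bullet> fst v) * (fst w \<bullet> fst x))) (at p)"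
    by (simp add: f_def)
  have L: "hyp_factor (fst p) = 2 / D"
    by (simp add: hyp_factor_def D_def power2_norm_eq_inner)
  have E: "H2R_metric p (H2R_christoffel p v w) x + H2R_metric p w (H2R_christoffel p v x)
      = 2 * (2 / D) ^ 3 * (fst p \<bullet> fst v) * (fst w \<bullet> fst x)" for v
    unfolding H2R_metric_def H2R_christoffel_def L fst_conv snd_conv
    by (simp add: inner_commute inner_add_left inner_add_right inner_diff_left
        inner_diff_right power2_eq_square power3_eq_cube algebra_simps)
  show ?thesis
    unfolding E using H by (simp add: H2R_metric_def hyp_factor_def power2_norm_eq_inner)
qed


section \<open>Mean curvature of a parametrised surface\<close>

text \<open>Parameter domains are subsets of \<open>complex\<close>, viewed as the plane; the coordinate directions are
  \<open>1\<close> and \<open>\<i>\<close>.\<close>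

definition dir_deriv ::
  "complex \<Rightarrow> (complex \<Rightarrow> complex \<times> real) \<Rightarrow> complex \<Rightarrow> complex \<times> real"
  where "dir_deriv h F z = frechet_derivative F (at z) h"

definition C2_on :: "(complex \<Rightarrow> complex \<times> real) \<Rightarrow> complex set \<Rightarrow> bool"
  where "C2_on F W \<longleftrightarrow>
    (\<forall>z\<in>W. F differentiable (at z)) \<and>
    (\<forall>h. \<forall>z\<in>W. dir_deriv h F differentiable (at z)) \<and>
    (\<forall>h k. continuous_on W (dir_deriv k (dir_deriv h F)))"

definition first_form ::
  "(complex \<Rightarrow> complex \<times> real) \<Rightarrow> complex \<Rightarrow> complex \<Rightarrow> complex \<Rightarrow> real"
  where "first_form F z h k = H2R_metric (F z) (dir_deriv h F z) (dir_deriv k F z)"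

definition unit_normal :: "(complex \<Rightarrow> complex \<times> real) \<Rightarrow> complex \<Rightarrow> complex \<times> real \<Rightarrow> bool"
  where "unit_normal F z N \<longleftrightarrow>
    H2R_metric (F z) N N = 1 \<and> (\<forall>h. H2R_metric (F z) N (dir_deriv h F z) = 0)"

definition second_form ::
  "(complex \<Rightarrow> complex \<times> real) \<Rightarrow> complex \<Rightarrow> complex \<times> real \<Rightarrow> complex \<Rightarrow> complex \<Rightarrow> real"
  where "second_form F z N h k =
    H2R_metric (F z)
      (dir_deriv h (dir_deriv k F) z
        + H2R_christoffel (F z) (dir_deriv h F z) (dir_deriv k F z)) N"

definition mean_curvature ::
  "(complex \<Rightarrow> complex \<times> real) \<Rightarrow> complex \<Rightarrow> complex \<times> real \<Rightarrow> real"
  where "mean_curvature F z N =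
    (first_form F z 1 1 * second_form F z N \<i> \<i>
      - 2 * first_form F z 1 \<i> * second_form F z N 1 \<i>
      + first_form F z \<i> \<i> * second_form F z N 1 1)
    / (2 * (first_form F z 1 1 * first_form F z \<i> \<i> - (first_form F z 1 \<i>)\<^sup>2))"


section \<open>Surfaces with boundary and minimal immersions\<close>

definition half_plane :: "complex set"
  where "half_plane = {z. 0 \<le> Im z}"

definition local_parametrisation ::
  "'a topology \<Rightarrow> complex set \<Rightarrow> 'a set \<Rightarrow> (complex \<Rightarrow> 'a) \<Rightarrow> bool"
  where "local_parametrisation S U V \<psi> \<longleftrightarrow>
    openin (top_of_set half_plane) U \<and> openin S V \<and>
    homeomorphic_map (top_of_set U) (subtopology S V) \<psi>"

definition surface_with_boundary :: "'a topology \<Rightarrow> bool"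
  where "surface_with_boundary S \<longleftrightarrow>
    Hausdorff_space S \<and> second_countable S \<and>
    (\<forall>p\<in>topspace S. \<exists>U V \<psi>. local_parametrisation S U V \<psi> \<and> p \<in> V)"

definition surface_boundary :: "'a topology \<Rightarrow> 'a set"
  where "surface_boundary S =
    {p. \<exists>U V \<psi> z. local_parametrisation S U V \<psi> \<and> z \<in> U \<and> Im z = 0 \<and> \<psi> z = p}"

text \<open>As usual for domains in a half-plane, regularity up to the boundary means that the map extends
  to an open subset of the plane; at points of \<open>U\<close> the first and second derivatives do not depend on
  the extension \<open>F\<close>.\<close>

definition minimal_parametrised :: "complex set \<Rightarrow> (complex \<Rightarrow> complex \<times> real) \<Rightarrow> bool"
  where "minimal_parametrised U f \<longleftrightarrow>
    f ` U \<subseteq> H2R \<and>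
    (\<exists>W F. open W \<and> U \<subseteq> W \<and> C2_on F W \<and> (\<forall>z\<in>U. F z = f z) \<and>
      (\<forall>z\<in>U. inj (frechet_derivative F (at z)) \<and>
             (\<forall>N. unit_normal F z N \<longrightarrow> mean_curvature F z N = 0)))"

text \<open>No differentiable structure is put on the abstract surface \<open>S\<close>: it is the one induced by \<open>X\<close>.
  Indeed if \<open>X \<circ> \<psi>\<close> and \<open>X \<circ> \<psi>'\<close> are \<open>C\<^sup>2\<close> immersions for two local
  parametrisations, then the change of coordinates between them is automatically \<open>C\<^sup>2\<close>.
  The surface \<open>M\<close> is \<open>X\<close> on \<open>S\<close>, with image \<open>X ` topspace S\<close>; its finite boundary is \<open>X\<close> on
  \<open>surface_boundary S\<close>, possibly empty.\<close>

definition properly_immersed_minimal_surface ::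
  "'a topology \<Rightarrow> ('a \<Rightarrow> complex \<times> real) \<Rightarrow> bool"
  where "properly_immersed_minimal_surface S X \<longleftrightarrow>
    surface_with_boundary S \<and>
    continuous_map S (top_of_set H2R) X \<and> proper_map S (top_of_set H2R) X \<and>
    (\<forall>p\<in>topspace S. \<exists>U V \<psi>.
       local_parametrisation S U V \<psi> \<and> p \<in> V \<and> minimal_parametrised U (X \<circ> \<psi>))"

text \<open>Since \<open>M\<close> is only immersed, \<open>M \<union> \<gamma>\<close> is understood as the disjoint union of the abstract
  surface \<open>S\<close> and of \<open>\<gamma>\<close>, mapped to the closed space by \<open>X\<close> on \<open>S\<close> and by the inclusion on \<open>\<gamma>\<close>.\<close>

definition continuous_surface_with_boundary ::
  "'a topology \<Rightarrow> ('a \<Rightarrow> complex \<times> real) \<Rightarrow> (complex \<times> real) set \<Rightarrow> bool"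
  where "continuous_surface_with_boundary S X \<gamma> \<longleftrightarrow>
    (\<exists>T :: ('a + complex \<times> real) topology.
       topspace T = Inl ` topspace S \<union> Inr ` \<gamma> \<and>
       embedding_map S T Inl \<and> embedding_map (top_of_set \<gamma>) T Inr \<and>
       surface_with_boundary T \<and> Inr ` \<gamma> \<subseteq> surface_boundary T \<and>
       continuous_map T (top_of_set H2R_closed) (case_sum X (\<lambda>p. p)))"

end

theory Submission
  imports Defs
begin

text \<open>
  The mechanism is the maximum principle, with barriers that imitate the rotational catenoids of
  \<open>H\<^sup>2 \<times> R\<close>. All these catenoids have height less than \<open>\<pi>\<close>, with \<open>\<pi>\<close> as supremum, which is why a slab of
  height \<open>\<pi>\<close> occurs in the theorem. For \<open>\<kappa> > 1\<close> let \<open>w(z, t) = cosh d(p, z) cos (\<kappa> (t - c))\<close>. Inside a slab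
  of height less than \<open>\<pi> / \<kappa>\<close>, the solid \<open>{w \<le> C}\<close> is a bounded neighbourhood of a piece of the axis
  \<open>{p} \<times> R\<close>, and for large \<open>C\<close> the mean curvature vector of its boundary points into the solid. A minimal surface
  outside the solid therefore cannot touch it at an interior point of the surface
  (\<open>no_interior_contact\<close>). Explicit functions replace the catenoids because everything needed
  about them is the identities \<open>Hess f = f g\<close> and \<open>|grad f|\<^sup>2 = f\<^sup>2 - 1\<close> for \<open>f = cosh d(p, _)\<close>.

  Suppose that the surface \<open>M\<close> exists. Consider in the abstract surface \<open>M \<union> \<gamma>\<close> the compact set \<open>E\<close> of points of
  \<open>\<gamma>'\<close> on the line \<open>L = {q} \<times> R\<close>. No end point of \<open>\<gamma>'\<close> is in \<open>E\<close>, so \<open>E\<close> has a compact neighbourhood \<open>Q\<close> that meets \<open>\<gamma>\<close> only in \<open>\<gamma>'\<close> and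
  contains no finite boundary point of \<open>M\<close> (\<open>half_disc_neighbourhood\<close>; this rests on invariance of
  domain). The set \<open>Q\<close> meets \<open>L\<close> exactly in \<open>E\<close>. Hence, by compactness, the points of \<open>Q\<close> over a
  small neighbourhood of \<open>q\<close> in the closed disc are interior to \<open>Q\<close>, and their heights stay in a
  slab of height less than \<open>\<pi>\<close>.

  Now place the axis of a barrier over a point \<open>p\<close> very close to the circle at infinity. A hyperbolic
  disc of fixed radius around \<open>p\<close> is then Euclidean small. As \<open>\<gamma>'\<close> stays on one side of \<open>L\<close>, there are
  points \<open>a\<close> of the circle arbitrarily near \<open>q\<close> that are not below \<open>\<gamma>'\<close>
  (\<open>one_side_free_point\<close>), and the barrier with axis close to \<open>a\<close> does not meet \<open>Q\<close>. Slide the axis from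
  there to a point below \<open>M\<close> near \<open>q\<close>, where the barrier does meet \<open>Q\<close>. The barriers never
  reach the circle at infinity and stay over the small neighbourhood of \<open>q\<close>, so the first
  contact (\<open>sliding_barrier_contact\<close>) is at an interior point of \<open>M\<close>, which is impossible.
\<close>


section \<open>Symmetry of the second derivatives of a parametrisation\<close>

lemma line_has_vector_derivative:
  assumes "F differentiable (at (z + s *\<^sub>R h))"
  shows "((\<lambda>s. F (z + s *\<^sub>R h)) has_vector_derivative dir_deriv h F (z + s *\<^sub>R h)) (at s)"
proof -
  have 1: "((\<lambda>s. z + s *\<^sub>R h) has_derivative (\<lambda>s. s *\<^sub>R h)) (at s)"
    by (auto intro!: derivative_eq_intros)
  have 2: "(F has_derivative frechet_derivative F (at (z + s *\<^sub>R h))) (at (z + s *\<^sub>R h))"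
    using assms frechet_derivative_works by blast
  have lin: "linear (frechet_derivative F (at (z + s *\<^sub>R h)))"
    using 2 has_derivative_linear by blast
  show ?thesis
    using diff_chain_at[OF 1 2] lin
    by (simp add: has_vector_derivative_def dir_deriv_def o_def linear_scale)
qed

text \<open>The second difference is symmetric in \<open>h\<close> and \<open>k\<close>. Two applications of the mean value theorem, first
  in direction \<open>h\<close> and then in direction \<open>k\<close>, express it by one of the two mixed derivatives.
  A vector \<open>u\<close> is paired with the values because the mean value theorem holds only for real functions.\<close>

lemma second_difference_mean_value:
  fixes F :: "complex \<Rightarrow> complex \<times> real"
  assumes C2: "C2_on F W" and "0 < s"
    and W: "\<And>x y. x \<in> {0..s} \<Longrightarrow> y \<in> {0..s} \<Longrightarrow> z + x *\<^sub>R h + y *\<^sub>R k \<in> W"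
  shows "\<exists>x\<in>{0..s}. \<exists>y\<in>{0..s}.
    u \<bullet> (F (z + s *\<^sub>R h + s *\<^sub>R k) - F (z + s *\<^sub>R h) - F (z + s *\<^sub>R k) + F z)
      = s\<^sup>2 * (u \<bullet> dir_deriv k (dir_deriv h F) (z + x *\<^sub>R h + y *\<^sub>R k))"
proof -
  define G where "G = (\<lambda>x. u \<bullet> F (z + s *\<^sub>R k + x *\<^sub>R h) - u \<bullet> F (z + x *\<^sub>R h))"
  define G' where "G' = (\<lambda>x. u \<bullet> dir_deriv h F (z + s *\<^sub>R k + x *\<^sub>R h) - u \<bullet> dir_deriv h F (z + x *\<^sub>R h))"
  have diff: "F differentiable (at v)" "dir_deriv h F differentiable (at v)" if "v \<in> W" for v
    using C2 that unfolding C2_on_def by auto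
  have "(G has_real_derivative G' x) (at x)" if "0 \<le> x" "x \<le> s" for x
  proof -
    have "z + s *\<^sub>R k + x *\<^sub>R h \<in> W" "z + x *\<^sub>R h \<in> W"
      using W[of x s] W[of x 0] that \<open>0 < s\<close> by (auto simp: algebra_simps)
    then have "((\<lambda>x. F (z + s *\<^sub>R k + x *\<^sub>R h)) has_vector_derivative dir_deriv h F (z + s *\<^sub>R k + x *\<^sub>R h)) (at x)"
      "((\<lambda>x. F (z + x *\<^sub>R h)) has_vector_derivative dir_deriv h F (z + x *\<^sub>R h)) (at x)"
      using line_has_vector_derivative diff by blast+
    then show ?thesis
      unfolding G_def G'_def has_real_derivative_iff_has_vector_derivative
      by (intro has_vector_derivative_diff
          bounded_linear.has_vector_derivative[OF bounded_linear_inner_right])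
  qed
  then obtain x where x: "0 < x" "x < s" "G s - G 0 = (s - 0) * G' x"
    using MVT2[of 0 s G G'] \<open>0 < s\<close> by auto
  define K where "K = (\<lambda>y. u \<bullet> dir_deriv h F (z + x *\<^sub>R h + y *\<^sub>R k))"
  define K' where "K' = (\<lambda>y. u \<bullet> dir_deriv k (dir_deriv h F) (z + x *\<^sub>R h + y *\<^sub>R k))"
  have "(K has_real_derivative K' y) (at y)" if "0 \<le> y" "y \<le> s" for y
  proof -
    have "z + x *\<^sub>R h + y *\<^sub>R k \<in> W"
      using W[of x y] that x by auto
    then have "((\<lambda>y. dir_deriv h F (z + x *\<^sub>R h + y *\<^sub>R k)) has_vector_derivative
        dir_deriv k (dir_deriv h F) (z + x *\<^sub>R h + y *\<^sub>R k)) (at y)"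
      using line_has_vector_derivative diff by blast
    then show ?thesis
      unfolding K_def K'_def has_real_derivative_iff_has_vector_derivative
      by (rule bounded_linear.has_vector_derivative[OF bounded_linear_inner_right])
  qed
  then obtain y where y: "0 < y" "y < s" "K s - K 0 = (s - 0) * K' y"
    using MVT2[of 0 s K K'] \<open>0 < s\<close> by auto
  have "K s - K 0 = G' x"
    by (simp add: K_def G'_def algebra_simps)
  moreover have "G s - G 0 = u \<bullet> (F (z + s *\<^sub>R h + s *\<^sub>R k) - F (z + s *\<^sub>R h) - F (z + s *\<^sub>R k) + F z)"
    by (simp add: G_def algebra_simps)
  ultimately have "u \<bullet> (F (z + s *\<^sub>R h + s *\<^sub>R k) - F (z + s *\<^sub>R h) - F (z + s *\<^sub>R k) + F z)
      = s\<^sup>2 * (u \<bullet> dir_deriv k (dir_deriv h F) (z + x *\<^sub>R h + y *\<^sub>R k))"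
    using x(3) y(3) unfolding K'_def power2_eq_square
    by (metis diff_zero mult.assoc)
  then show ?thesis
    using x y by (meson atLeastAtMost_iff less_imp_le)
qed

text \<open>The mean curvature contains only one of the two mixed derivatives, whereas the second derivative
  along a line in the parameter plane contains their sum; hence the need for Schwarz's theorem. Both mixed derivatives
  are limits of the same second difference quotient.\<close>

lemma dir_deriv_commute:
  assumes C2: "C2_on F W" and "open W" "z \<in> W"
  shows "dir_deriv k (dir_deriv h F) z = dir_deriv h (dir_deriv k F) z" (is "?A z = ?B z")
proof (rule ccontr)
  assume "?A z \<noteq> ?B z"
  define e where "e = norm (?A z - ?B z)"
  have e: "e > 0" using \<open>?A z \<noteq> ?B z\<close> by (simp add: e_def)
  have cont: "isCont ?A z" "isCont ?B z"
    using C2 \<open>open W\<close> \<open>z \<in> W\<close> unfolding C2_on_def by (auto simp: continuous_on_eq_continuous_at)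
  obtain d1 where d1: "d1 > 0" "\<And>w. dist w z < d1 \<Longrightarrow> dist (?A w) (?A z) < e / 2"
    using cont(1) e unfolding continuous_at_eps_delta by (meson half_gt_zero)
  obtain d2 where d2: "d2 > 0" "\<And>w. dist w z < d2 \<Longrightarrow> dist (?B w) (?B z) < e / 2"
    using cont(2) e unfolding continuous_at_eps_delta by (meson half_gt_zero)
  obtain d3 where d3: "d3 > 0" "ball z d3 \<subseteq> W"
    using \<open>open W\<close> \<open>z \<in> W\<close> openE by blast
  define d where "d = min d1 (min d2 d3)"
  have "d > 0" using d1 d2 d3 by (simp add: d_def)
  define s where "s = d / (norm h + norm k + 1)"
  have pos: "norm h + norm k + 1 > 0" by (smt (verit) norm_ge_zero)
  have s: "s > 0" "s * (norm h + norm k) < d"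
  proof -
    show "s > 0" unfolding s_def using \<open>d > 0\<close> pos by simp
    have "s * (norm h + norm k + 1) = d" using pos by (simp add: s_def)
    then show "s * (norm h + norm k) < d" using \<open>s > 0\<close> by (simp add: algebra_simps)
  qed
  have near: "dist (z + x *\<^sub>R h + y *\<^sub>R k) z < d" if "x \<in> {0..s}" "y \<in> {0..s}" for x y
  proof -
    have "dist (z + x *\<^sub>R h + y *\<^sub>R k) z = norm (x *\<^sub>R h + y *\<^sub>R k)"
      by (simp add: dist_norm algebra_simps)
    also have "\<dots> \<le> x * norm h + y * norm k"
      using that by (intro order_trans[OF norm_triangle_ineq]) auto
    also have "\<dots> \<le> s * norm h + s * norm k"
      using that by (intro add_mono mult_right_mono) auto
    finally show ?thesis using s by (simp add: algebra_simps)
  qed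
  have W: "z + x *\<^sub>R h + y *\<^sub>R k \<in> W" if "x \<in> {0..s}" "y \<in> {0..s}" for x y
    using near[OF that] d3 by (auto simp: d_def dist_commute subset_eq)
  have W': "z + x *\<^sub>R k + y *\<^sub>R h \<in> W" if "x \<in> {0..s}" "y \<in> {0..s}" for x y
    using W[OF that(2,1)] by (simp add: algebra_simps)
  define u where "u = ?A z - ?B z"
  obtain x y where xy: "x \<in> {0..s}" "y \<in> {0..s}"
      "u \<bullet> (F (z + s *\<^sub>R h + s *\<^sub>R k) - F (z + s *\<^sub>R h) - F (z + s *\<^sub>R k) + F z)
      = s\<^sup>2 * (u \<bullet> ?A (z + x *\<^sub>R h + y *\<^sub>R k))"
    using second_difference_mean_value[OF C2 \<open>s > 0\<close> W, of u] by blast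
  obtain x' y' where xy': "x' \<in> {0..s}" "y' \<in> {0..s}"
      "u \<bullet> (F (z + s *\<^sub>R k + s *\<^sub>R h) - F (z + s *\<^sub>R k) - F (z + s *\<^sub>R h) + F z)
      = s\<^sup>2 * (u \<bullet> ?B (z + x' *\<^sub>R k + y' *\<^sub>R h))"
    using second_difference_mean_value[OF C2 \<open>s > 0\<close> W', of u] by blast
  let ?w = "z + x *\<^sub>R h + y *\<^sub>R k" and ?w' = "z + x' *\<^sub>R k + y' *\<^sub>R h"
  have "s\<^sup>2 * (u \<bullet> ?A ?w) = s\<^sup>2 * (u \<bullet> ?B ?w')"
    using xy(3) xy'(3) by (simp add: algebra_simps)
  then have eq: "u \<bullet> ?A ?w = u \<bullet> ?B ?w'" using s by simp
  have "dist (?A ?w) (?A z) < e / 2"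
    using d1(2) near[OF xy(1,2)] by (simp add: d_def)
  moreover have "dist (?B ?w') (?B z) < e / 2"
    using d2(2)[of ?w'] near[OF xy'(2,1)] by (simp add: d_def algebra_simps)
  ultimately have lt: "norm ((?A z - ?A ?w) + (?B ?w' - ?B z)) < e"
    by (smt (verit, best) dist_norm norm_minus_commute norm_triangle_ineq field_sum_of_halves)
  have "e * e = u \<bullet> (?A z - ?B z)"
    unfolding u_def e_def by (simp add: power2_norm_eq_inner[symmetric] power2_eq_square)
  also have "\<dots> = u \<bullet> ((?A z - ?A ?w) + (?B ?w' - ?B z))"
    using eq by (simp add: inner_diff_right inner_add_right)
  also have "\<dots> \<le> e * norm ((?A z - ?A ?w) + (?B ?w' - ?B z))"
    using norm_cauchy_schwarz[of u] by (simp add: u_def e_def)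
  also have "\<dots> < e * e" using lt e by simp
  finally show False by simp
qed


section \<open>The hyperbolic cosine of the distance to a point\<close>

text \<open>This is \<open>cosh d(p, z)\<close>, see \<open>hyp_cosh_eq\<close> for the usual formula. The form chosen here is affine in \<open>\<lambda>\<close> and
  \<open>\<lambda> z\<close> for \<open>\<lambda> = hyp_factor z\<close>, which up to a constant are the coordinates on the hyperboloid; this keeps derivatives short.\<close>

definition hyp_cosh :: "complex \<Rightarrow> complex \<Rightarrow> real"
  where "hyp_cosh p z = hyp_factor z * ((1 + p \<bullet> p) - 2 * (p \<bullet> z)) / (1 - p \<bullet> p) - (1 + p \<bullet> p) / (1 - p \<bullet> p)"

text \<open>The Euclidean gradient in the disk coordinate \<open>z\<close>; the Riemannian one is obtained on division by \<open>\<lambda>\<^sup>2\<close>.\<close>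

definition hyp_cosh_grad :: "complex \<Rightarrow> complex \<Rightarrow> complex"
  where "hyp_cosh_grad p z =
    ((hyp_factor z)\<^sup>2 * ((1 + p \<bullet> p) - 2 * (p \<bullet> z)) / (1 - p \<bullet> p)) *\<^sub>R z - (hyp_factor z * 2 / (1 - p \<bullet> p)) *\<^sub>R p"

lemma norm_less_1_inner: "norm (z::complex) < 1 \<Longrightarrow> z \<bullet> z < 1"
  by (metis abs_norm_cancel abs_square_less_1 power2_norm_eq_inner)

lemma hyp_cosh_eq:
  assumes "norm p < 1" "norm z < 1"
  shows "hyp_cosh p z = 1 + 2 * (norm (z - p))\<^sup>2 / ((1 - (norm p)\<^sup>2) * (1 - (norm z)\<^sup>2))"
proof -
  have "1 - p \<bullet> p \<noteq> 0" "1 - z \<bullet> z \<noteq> 0"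
    using assms norm_less_1_inner by (smt (verit))+
  then show ?thesis
    unfolding hyp_cosh_def hyp_factor_def power2_norm_eq_inner
    by (simp add: divide_simps inner_diff_left inner_diff_right inner_commute) (simp add: algebra_simps)
qed

lemma hyp_cosh_ge_1:
  assumes "norm p < 1" "norm z < 1"
  shows "hyp_cosh p z \<ge> 1"
proof -
  have "1 - (norm p)\<^sup>2 > 0" "1 - (norm z)\<^sup>2 > 0"
    using assms by (auto simp: abs_square_less_1)
  then show ?thesis by (simp add: hyp_cosh_eq assms)
qed

lemma hyp_factor_inner:
  assumes "norm z < 1"
  shows "hyp_factor z > 0" "hyp_factor z * (z \<bullet> z) = hyp_factor z - 2"
  using norm_less_1_inner[OF assms]
  by (auto simp: hyp_factor_def power2_norm_eq_inner divide_simps algebra_simps)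

text \<open>In terms of the hyperbolic metric this is \<open>|grad f|\<^sup>2 = f\<^sup>2 - 1\<close>, that is \<open>sinh\<^sup>2 = cosh\<^sup>2 - 1\<close>. The proof uses the linear form
  \<open>f = \<lambda> k - a\<close> with \<open>k = a - b \<bullet> z\<close> and \<open>|b|\<^sup>2 = a\<^sup>2 - 1\<close>.\<close>

lemma norm_hyp_cosh_grad:
  assumes "norm p < 1" "norm z < 1"
  shows "hyp_cosh_grad p z \<bullet> hyp_cosh_grad p z = (hyp_factor z)\<^sup>2 * ((hyp_cosh p z)\<^sup>2 - 1)"
proof -
  have nz: "1 - p \<bullet> p \<noteq> 0" "1 - z \<bullet> z \<noteq> 0"
    using assms norm_less_1_inner by (smt (verit))+
  define a where "a = (1 + p \<bullet> p) / (1 - p \<bullet> p)"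
  define b where "b = (2 / (1 - p \<bullet> p)) *\<^sub>R p"
  define k where "k = a - b \<bullet> z"
  define l where "l = hyp_factor z"
  have l: "l * (z \<bullet> z) = l - 2" using hyp_factor_inner assms by (simp add: l_def)
  have ab: "b \<bullet> b = a\<^sup>2 - 1"
    using nz by (simp add: a_def b_def divide_simps power2_eq_square) (simp add: algebra_simps)
  have k: "((1 + p \<bullet> p) - 2 * (p \<bullet> z)) / (1 - p \<bullet> p) = k"
    using nz by (simp add: k_def a_def b_def divide_simps)
  have f: "hyp_cosh p z = l * k - a"
    unfolding hyp_cosh_def k[symmetric] l_def a_def by simp
  have g: "hyp_cosh_grad p z = l *\<^sub>R ((l * k) *\<^sub>R z - b)"
    unfolding hyp_cosh_grad_def k[symmetric] l_def b_def
    by (simp add: scaleR_diff_right power2_eq_square)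
  have bz: "b \<bullet> z = a - k" by (simp add: k_def)
  have "((l * k) *\<^sub>R z - b) \<bullet> ((l * k) *\<^sub>R z - b)
      = (l * k\<^sup>2) * (l * (z \<bullet> z)) - 2 * l * k * (b \<bullet> z) + b \<bullet> b"
    by (simp add: inner_diff_left inner_diff_right inner_commute power2_eq_square algebra_simps)
  also have "\<dots> = (l * k - a)\<^sup>2 - 1"
    unfolding l bz ab by (simp add: power2_eq_square algebra_simps)
  finally show ?thesis
    unfolding f g l_def[symmetric] by (simp add: power2_eq_square)
qed

lemma hyp_factor_derivative:
  assumes "(\<zeta> has_vector_derivative \<zeta>') (at s)" "norm (\<zeta> s) < 1"
  shows "((\<lambda>s. hyp_factor (\<zeta> s)) has_real_derivative (hyp_factor (\<zeta> s))\<^sup>2 * (\<zeta> s \<bullet> \<zeta>')) (at s)"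
proof -
  have nz: "1 - \<zeta> s \<bullet> \<zeta> s \<noteq> 0" using norm_less_1_inner[OF assms(2)] by simp
  have "((\<lambda>s. \<zeta> s \<bullet> \<zeta> s) has_real_derivative 2 * (\<zeta> s \<bullet> \<zeta>')) (at s)"
    unfolding has_field_derivative_def
    by (rule has_derivative_eq_rhs[OF has_derivative_inner[OF assms(1)[unfolded has_vector_derivative_def] assms(1)[unfolded has_vector_derivative_def]]])
       (auto simp: inner_commute)
  from DERIV_cdivide[OF DERIV_const] this nz
  show ?thesis
    unfolding hyp_factor_def power2_norm_eq_inner
    by (auto intro!: derivative_eq_intros simp: divide_simps power2_eq_square)
qed

lemma inner_derivative:
  assumes "(\<zeta> has_vector_derivative \<zeta>') (at s)" "(\<eta> has_vector_derivative \<eta>') (at s)"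
  shows "((\<lambda>s. \<zeta> s \<bullet> \<eta> s) has_real_derivative \<zeta>' \<bullet> \<eta> s + \<zeta> s \<bullet> \<eta>') (at s)"
  unfolding has_field_derivative_def
  by (rule has_derivative_eq_rhs[OF has_derivative_inner[OF assms[unfolded has_vector_derivative_def]]])
     (auto simp: algebra_simps)

lemma hyp_cosh_derivative:
  assumes "(\<zeta> has_vector_derivative \<zeta>') (at s)" "norm (\<zeta> s) < 1"
  shows "((\<lambda>s. hyp_cosh p (\<zeta> s)) has_real_derivative hyp_cosh_grad p (\<zeta> s) \<bullet> \<zeta>') (at s)"
proof -
  define r where "r = inverse (1 - p \<bullet> p)"
  have "((\<lambda>s. p \<bullet> \<zeta> s) has_real_derivative p \<bullet> \<zeta>') (at s)"
    using inner_derivative[OF has_vector_derivative_const assms(1)] by simp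
  note [derivative_intros] = this hyp_factor_derivative[OF assms]
  show ?thesis
    unfolding hyp_cosh_def hyp_cosh_grad_def divide_inverse r_def[symmetric] inner_diff_left inner_scaleR_left
    by (rule derivative_eq_intros refl)+ algebra
qed

text \<open>This says \<open>Hess f = f g\<close> for \<open>f = cosh d(p, _)\<close>: along a curve, the second derivative of \<open>f\<close> is \<open>f\<close> times the
  squared speed plus the derivative of \<open>f\<close> in the direction of the covariant acceleration. The identity
  holds because \<open>f\<close> is the restriction of a linear function to the hyperboloid. The heights
  \<open>t, \<tau>, \<tau>'\<close> are arbitrary since the factor \<open>R\<close> is flat.\<close>

lemma hyp_cosh_second_derivative:
  assumes \<zeta>: "(\<zeta> has_vector_derivative \<eta> s) (at s)" and \<eta>: "(\<eta> has_vector_derivative \<eta>') (at s)"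
    and "norm (\<zeta> s) < 1"
  shows "((\<lambda>s. hyp_cosh_grad p (\<zeta> s) \<bullet> \<eta> s) has_real_derivative
     hyp_cosh p (\<zeta> s) * (hyp_factor (\<zeta> s))\<^sup>2 * (\<eta> s \<bullet> \<eta> s)
     + hyp_cosh_grad p (\<zeta> s) \<bullet>
        (\<eta>' + fst (H2R_christoffel (\<zeta> s, t) (\<eta> s, \<tau>) (\<eta> s, \<tau>')))) (at s)"
proof -
  define a where "a = (1 + p \<bullet> p) / (1 - p \<bullet> p)"
  define b where "b = (2 / (1 - p \<bullet> p)) *\<^sub>R p"
  define k where "k = (\<lambda>z. a - b \<bullet> z)"
  have k: "((1 + p \<bullet> p) - 2 * (p \<bullet> z)) / (1 - p \<bullet> p) = k z" for z
    by (simp add: k_def a_def b_def diff_divide_distrib)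
  have f: "hyp_cosh p z = hyp_factor z * k z - a" for z
    unfolding hyp_cosh_def k[symmetric] a_def by simp
  have g: "hyp_cosh_grad p z = ((hyp_factor z)\<^sup>2 * k z) *\<^sub>R z - hyp_factor z *\<^sub>R b" for z
    unfolding hyp_cosh_grad_def k[symmetric] b_def by simp
  define l where "l = hyp_factor (\<zeta> s)"
  have l: "l * (\<zeta> s \<bullet> \<zeta> s) = l - 2" using hyp_factor_inner assms by (simp add: l_def)
  have bz: "b \<bullet> \<zeta> s = a - k (\<zeta> s)" by (simp add: k_def)
  have dl: "((\<lambda>s. hyp_factor (\<zeta> s)) has_real_derivative l\<^sup>2 * (\<zeta> s \<bullet> \<eta> s)) (at s)"
    using hyp_factor_derivative assms by (simp add: l_def)
  have db: "((\<lambda>s. b \<bullet> \<zeta> s) has_real_derivative b \<bullet> \<eta> s) (at s)"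
    using inner_derivative[OF has_vector_derivative_const \<zeta>] by simp
  have dk: "((\<lambda>s. k (\<zeta> s)) has_real_derivative - (b \<bullet> \<eta> s)) (at s)"
    unfolding k_def by (auto intro!: derivative_eq_intros db)
  have db': "((\<lambda>s. b \<bullet> \<eta> s) has_real_derivative b \<bullet> \<eta>') (at s)"
    using inner_derivative[OF has_vector_derivative_const \<eta>] by simp
  have dz: "((\<lambda>s. \<zeta> s \<bullet> \<eta> s) has_real_derivative \<eta> s \<bullet> \<eta> s + \<zeta> s \<bullet> \<eta>') (at s)"
    by (rule inner_derivative[OF \<zeta> \<eta>])
  have eq: "hyp_cosh_grad p (\<zeta> s) \<bullet> \<eta> s
      = (hyp_factor (\<zeta> s))\<^sup>2 * k (\<zeta> s) * (\<zeta> s \<bullet> \<eta> s) - hyp_factor (\<zeta> s) * (b \<bullet> \<eta> s)" for s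
    unfolding g by (simp add: inner_diff_left)
  have D: "((\<lambda>s. hyp_cosh_grad p (\<zeta> s) \<bullet> \<eta> s) has_real_derivative
      2 * l * (l\<^sup>2 * (\<zeta> s \<bullet> \<eta> s)) * k (\<zeta> s) * (\<zeta> s \<bullet> \<eta> s) - l\<^sup>2 * (b \<bullet> \<eta> s) * (\<zeta> s \<bullet> \<eta> s)
      + l\<^sup>2 * k (\<zeta> s) * (\<eta> s \<bullet> \<eta> s + \<zeta> s \<bullet> \<eta>')
      - l\<^sup>2 * (\<zeta> s \<bullet> \<eta> s) * (b \<bullet> \<eta> s) - l * (b \<bullet> \<eta>')) (at s)"
    unfolding eq
    by (rule derivative_eq_intros dl dk db' dz refl)+
       (simp add: l_def[symmetric] algebra_simps power2_eq_square)
  define x where "x = \<zeta> s \<bullet> \<eta> s"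
  define e where "e = \<eta> s \<bullet> \<eta> s"
  have "hyp_cosh_grad p (\<zeta> s) \<bullet> fst (H2R_christoffel (\<zeta> s, t) (\<eta> s, \<tau>) (\<eta> s, \<tau>'))
     = 2 * l * x * (l\<^sup>2 * k (\<zeta> s) * x - l * (b \<bullet> \<eta> s))
       - l * e * (l * k (\<zeta> s) * (l * (\<zeta> s \<bullet> \<zeta> s)) - l * (b \<bullet> \<zeta> s))"
    unfolding g H2R_christoffel_def x_def e_def fst_conv l_def[symmetric]
      inner_diff_left inner_diff_right inner_add_left inner_add_right inner_scaleR_left inner_scaleR_right
    by algebra
  also have "\<dots> = 2 * l * x * (l\<^sup>2 * k (\<zeta> s) * x - l * (b \<bullet> \<eta> s))
       - l * e * (l * k (\<zeta> s) * (l - 2) - l * (a - k (\<zeta> s)))"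
    unfolding l bz ..
  finally have G: "hyp_cosh_grad p (\<zeta> s) \<bullet> fst (H2R_christoffel (\<zeta> s, t) (\<eta> s, \<tau>) (\<eta> s, \<tau>')) = \<dots>" .
  show ?thesis
    unfolding inner_add_right G
    unfolding f g l_def[symmetric] inner_diff_left inner_scaleR_left x_def[symmetric] e_def[symmetric]
    by (rule DERIV_cong[OF D[unfolded eq, folded x_def e_def]]) algebra
qed

text \<open>For a symmetric form \<open>q\<close> on \<open>R\<^sup>3\<close> and \<open>c = x \<times> y\<close>, the trace of \<open>q\<close> over the plane spanned by \<open>x\<close> and
  \<open>y\<close>, multiplied by the Gram determinant \<open>|c|\<^sup>2\<close>, is \<open>|c|\<^sup>2 tr q - q(c, c)\<close>. The left-hand side is the combination of
  coefficients that occurs in the numerator of the mean curvature.\<close>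

lemma cross_product_trace_identity:
  fixes x1 x2 x3 y1 y2 y3 :: real
  defines "c1 \<equiv> x2 * y3 - x3 * y2" and "c2 \<equiv> x3 * y1 - x1 * y3" and "c3 \<equiv> x1 * y2 - x2 * y1"
  assumes q: "\<And>u1 u2 u3 v1 v2 v3. q u1 u2 u3 v1 v2 v3 =
      A * (u1 * v1 + u2 * v2) + K * (u1 * v3 + u3 * v1) + L * (u2 * v3 + u3 * v2) + B * u3 * (v3::real)"
  shows "(x1*x1 + x2*x2 + x3*x3) * q y1 y2 y3 y1 y2 y3 - 2 * (x1*y1 + x2*y2 + x3*y3) * q x1 x2 x3 y1 y2 y3
    + (y1*y1 + y2*y2 + y3*y3) * q x1 x2 x3 x1 x2 x3
    = (c1*c1 + c2*c2 + c3*c3) * (2 * A + B) - q c1 c2 c3 c1 c2 c3"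
  unfolding q c1_def c2_def c3_def by algebra


section \<open>Catenoid-like barriers\<close>

text \<open>The axis is \<open>{p} \<times> R\<close>, the plane of symmetry has height \<open>c\<close>, and the solid \<open>{barrier \<le> C}\<close>, restricted to
  \<open>|t - c| < \<pi> / (2 \<kappa>)\<close>, has its waist at distance \<open>arcosh C\<close> from the axis and widens to infinity at both ends.\<close>

definition barrier :: "real \<Rightarrow> real \<Rightarrow> complex \<Rightarrow> complex \<times> real \<Rightarrow> real"
  where "barrier \<kappa> c p x = hyp_cosh p (fst x) * cos (\<kappa> * (snd x - c))"

definition barrier_deriv :: "real \<Rightarrow> real \<Rightarrow> complex \<Rightarrow> complex \<times> real \<Rightarrow> complex \<times> real \<Rightarrow> real"
  where "barrier_deriv \<kappa> c p x v =
    cos (\<kappa> * (snd x - c)) * (hyp_cosh_grad p (fst x) \<bullet> fst v)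
    - \<kappa> * sin (\<kappa> * (snd x - c)) * hyp_cosh p (fst x) * snd v"

text \<open>The covariant Hessian of the barrier in \<open>H\<^sup>2 \<times> R\<close>, by the product rule and \<open>Hess f = f g\<close>.\<close>

definition barrier_hessian ::
  "real \<Rightarrow> real \<Rightarrow> complex \<Rightarrow> complex \<times> real \<Rightarrow> complex \<times> real \<Rightarrow> complex \<times> real \<Rightarrow> real"
  where "barrier_hessian \<kappa> c p x v w =
    hyp_cosh p (fst x) * cos (\<kappa> * (snd x - c)) * (hyp_factor (fst x))\<^sup>2 * (fst v \<bullet> fst w)
    - \<kappa> * sin (\<kappa> * (snd x - c)) *
        ((hyp_cosh_grad p (fst x) \<bullet> fst v) * snd w + (hyp_cosh_grad p (fst x) \<bullet> fst w) * snd v)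
    - \<kappa>\<^sup>2 * hyp_cosh p (fst x) * cos (\<kappa> * (snd x - c)) * snd v * snd w"

lemma barrier_derivative:
  assumes "(x has_vector_derivative v) (at s)" "norm (fst (x s)) < 1"
  shows "((\<lambda>s. barrier \<kappa> c p (x s)) has_real_derivative barrier_deriv \<kappa> c p (x s) v) (at s)"
proof -
  have 1: "((\<lambda>s. fst (x s)) has_vector_derivative fst v) (at s)"
    by (rule bounded_linear.has_vector_derivative[OF bounded_linear_fst assms(1)])
  have 2: "((\<lambda>s. snd (x s)) has_real_derivative snd v) (at s)"
    unfolding has_real_derivative_iff_has_vector_derivative
    by (rule bounded_linear.has_vector_derivative[OF bounded_linear_snd assms(1)])
  note [derivative_intros] = hyp_cosh_derivative[OF 1 assms(2)] 2
  show ?thesis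
    unfolding barrier_def barrier_deriv_def
    by (rule derivative_eq_intros refl)+ (simp add: algebra_simps)
qed

text \<open>As for \<open>hyp_cosh\<close>, the first summand is the covariant Hessian and the second one the derivative in
  the direction of the covariant acceleration.\<close>

lemma barrier_second_derivative:
  assumes x: "(x has_vector_derivative v s) (at s)" and vd: "(v has_vector_derivative a) (at s)"
    and "norm (fst (x s)) < 1"
  shows "((\<lambda>s. barrier_deriv \<kappa> c p (x s) (v s)) has_real_derivative
    barrier_hessian \<kappa> c p (x s) (v s) (v s)
    + barrier_deriv \<kappa> c p (x s) (a + H2R_christoffel (x s) (v s) (v s))) (at s)"
proof -
  have 1: "((\<lambda>s. fst (x s)) has_vector_derivative fst (v s)) (at s)"
    by (rule bounded_linear.has_vector_derivative[OF bounded_linear_fst x])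
  have dv1: "((\<lambda>s. fst (v s)) has_vector_derivative fst a) (at s)"
    by (rule bounded_linear.has_vector_derivative[OF bounded_linear_fst vd])
  have 2: "((\<lambda>s. snd (x s)) has_real_derivative snd (v s)) (at s)"
    unfolding has_real_derivative_iff_has_vector_derivative
    by (rule bounded_linear.has_vector_derivative[OF bounded_linear_snd x])
  have dv2: "((\<lambda>s. snd (v s)) has_real_derivative snd a) (at s)"
    unfolding has_real_derivative_iff_has_vector_derivative
    by (rule bounded_linear.has_vector_derivative[OF bounded_linear_snd vd])
  have 3: "((\<lambda>s. hyp_cosh_grad p (fst (x s)) \<bullet> fst (v s)) has_real_derivative
     hyp_cosh p (fst (x s)) * (hyp_factor (fst (x s)))\<^sup>2 * (fst (v s) \<bullet> fst (v s))
     + hyp_cosh_grad p (fst (x s)) \<bullet> (fst a + fst (H2R_christoffel (x s) (v s) (v s)))) (at s)"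
    using hyp_cosh_second_derivative[OF 1 dv1 assms(3), of p "snd (x s)" "snd (v s)" "snd (v s)"] by simp
  have 4: "snd (H2R_christoffel (x s) (v s) (v s)) = 0"
    by (simp add: H2R_christoffel_def)
  note [derivative_intros] = hyp_cosh_derivative[OF 1 assms(3)] 2 dv2 3
  show ?thesis
    unfolding barrier_deriv_def barrier_hessian_def fst_add snd_add 4
    by (rule derivative_eq_intros refl)+ (simp add: inner_add_right power2_eq_square algebra_simps)
qed

text \<open>The level sets of the barrier with large value \<open>C\<close> curve strictly to one side. In orthonormal
  coordinates, \<open>q\<close> is the Hessian of the barrier, \<open>(S d, -\<kappa>\<sigma>f)\<close> its gradient \<open>n\<close>, and \<open>x, y\<close> span the
  tangent plane of the level set. As \<open>x \<times> y\<close> is parallel to \<open>n\<close>, the sign is that of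
  \<open>|n|\<^sup>2 tr q - q(n, n) = C ((\<kappa>\<^sup>2 - 1) S\<^sup>2 + 2 \<kappa>\<^sup>2 \<sigma>\<^sup>2 - C\<^sup>2 (\<kappa>\<^sup>2 - 1))\<close>, and the hypothesis on \<open>C\<close> makes the last
  term win. For \<open>\<kappa> \<le> 1\<close> no \<open>C\<close> would do.\<close>

lemma tangential_trace_negative:
  fixes x1 x2 x3 y1 y2 y3 da db f S \<sigma> \<kappa> :: real
  assumes q: "\<And>u1 u2 u3 v1 v2 v3. q u1 u2 u3 v1 v2 v3 = f * S * (u1 * v1 + u2 * v2)
      - \<kappa> * \<sigma> * ((da * u1 + db * u2) * v3 + (da * v1 + db * v2) * u3) - \<kappa>\<^sup>2 * f * S * u3 * (v3::real)"
    and d: "da\<^sup>2 + db\<^sup>2 = f\<^sup>2 - 1" and S: "S\<^sup>2 + \<sigma>\<^sup>2 = 1" and "f * S = C" "C > 0"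
    and \<kappa>: "1 < \<kappa>" and C: "2 * \<kappa>\<^sup>2 < C\<^sup>2 * (\<kappa>\<^sup>2 - 1)"
    and x: "S * (da * x1 + db * x2) - \<kappa> * \<sigma> * f * x3 = 0"
    and y: "S * (da * y1 + db * y2) - \<kappa> * \<sigma> * f * y3 = 0"
    and ind: "(x1*x1 + x2*x2 + x3*x3) * (y1*y1 + y2*y2 + y3*y3) - (x1*y1 + x2*y2 + x3*y3)\<^sup>2 > 0"
  shows "(x1*x1 + x2*x2 + x3*x3) * q y1 y2 y3 y1 y2 y3 - 2 * (x1*y1 + x2*y2 + x3*y3) * q x1 x2 x3 y1 y2 y3
    + (y1*y1 + y2*y2 + y3*y3) * q x1 x2 x3 x1 x2 x3 < 0" (is "?L < 0")
proof -
  \<comment> \<open>the cross product of \<open>x\<close> and \<open>y\<close>, and the gradient\<close>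
  define c1 c2 c3 where c: "c1 = x2 * y3 - x3 * y2" "c2 = x3 * y1 - x1 * y3" "c3 = x1 * y2 - x2 * y1"
  define n1 n2 n3 where n: "n1 = S * da" "n2 = S * db" "n3 = - (\<kappa> * \<sigma> * f)"
  have L: "?L = (c1*c1 + c2*c2 + c3*c3) * (2 * (f * S) + - (\<kappa>\<^sup>2 * f * S)) - q c1 c2 c3 c1 c2 c3"
    unfolding c
    by (rule cross_product_trace_identity[where q = q and K = "- (\<kappa> * \<sigma> * da)" and L = "- (\<kappa> * \<sigma> * db)"])
       (simp add: q algebra_simps)
  have cpos: "c1*c1 + c2*c2 + c3*c3 > 0"
    using ind unfolding c by (simp add: power2_eq_square algebra_simps)
  have xn: "n1 * x1 + n2 * x2 + n3 * x3 = 0" "n1 * y1 + n2 * y2 + n3 * y3 = 0"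
    using x y by (simp_all add: n algebra_simps)
  define M where "M = n1*n1 + n2*n2 + n3*n3"
  define m where "m = n1*c1 + n2*c2 + n3*c3"
  have cn: "M * c1 = m * n1" "M * c2 = m * n2" "M * c3 = m * n3"
    using xn unfolding M_def m_def c by algebra+
  have "S \<noteq> 0" "f \<noteq> 0" using \<open>f * S = C\<close> \<open>C > 0\<close> by auto
  have Mval: "M = S\<^sup>2 * (f\<^sup>2 - 1) + \<kappa>\<^sup>2 * \<sigma>\<^sup>2 * f\<^sup>2"
    unfolding M_def n d[symmetric] by algebra
  have C1: "C > 1"
  proof (rule ccontr)
    assume "\<not> C > 1"
    then have "C\<^sup>2 \<le> 1" using \<open>C > 0\<close> by (simp add: power_le_one)
    moreover have "\<kappa>\<^sup>2 - 1 \<ge> 0" using \<kappa> by simp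
    ultimately have "C\<^sup>2 * (\<kappa>\<^sup>2 - 1) \<le> 1 * (\<kappa>\<^sup>2 - 1)" by (rule mult_right_mono)
    then show False using C by simp (smt (verit) zero_le_power2)
  qed
  have S1: "S\<^sup>2 \<le> 1" using S by (smt (verit) zero_le_power2)
  have Mpos: "M > 0"
  proof -
    have "S\<^sup>2 * (f\<^sup>2 - 1) = C\<^sup>2 - S\<^sup>2"
      using \<open>f * S = C\<close> by (auto simp: algebra_simps power_mult_distrib)
    moreover have "C\<^sup>2 > 1" using C1 by (simp add: one_less_power)
    ultimately show ?thesis unfolding Mval using S1 by (smt (verit) zero_le_power2 mult_nonneg_nonneg)
  qed
  have "M * M * ?L = m * m * (M * (2 * (f * S) + - (\<kappa>\<^sup>2 * f * S)) - q n1 n2 n3 n1 n2 n3)"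
  proof -
    have "M * M * (c1*c1 + c2*c2 + c3*c3) = m * m * M"
    proof -
      have "M * M * (c1*c1 + c2*c2 + c3*c3) = (M*c1)*(M*c1) + (M*c2)*(M*c2) + (M*c3)*(M*c3)"
        by algebra
      then show ?thesis unfolding cn by (simp add: M_def algebra_simps)
    qed
    moreover have "M * M * q c1 c2 c3 c1 c2 c3 = m * m * q n1 n2 n3 n1 n2 n3"
    proof -
      have "M * M * q c1 c2 c3 c1 c2 c3 = q (M*c1) (M*c2) (M*c3) (M*c1) (M*c2) (M*c3)"
        unfolding q by algebra
      then show ?thesis unfolding cn unfolding q by algebra
    qed
    ultimately show ?thesis unfolding L by algebra
  qed
  moreover have "m \<noteq> 0"
  proof
    assume "m = 0"
    then have "c1 = 0" "c2 = 0" "c3 = 0" using cn Mpos by auto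
    then show False using cpos by simp
  qed
  moreover have "M * (2 * (f * S) + - (\<kappa>\<^sup>2 * f * S)) - q n1 n2 n3 n1 n2 n3 < 0"
  proof -
    have "M * (2 * (f * S) + - (\<kappa>\<^sup>2 * f * S)) - q n1 n2 n3 n1 n2 n3
       = f * S * ((\<kappa>\<^sup>2 - 1) * S\<^sup>2 + 2 * \<kappa>\<^sup>2 * \<sigma>\<^sup>2 - (f * S)\<^sup>2 * (\<kappa>\<^sup>2 - 1))"
      unfolding Mval q n using d by algebra
    also have "\<dots> = C * ((\<kappa>\<^sup>2 - 1) * S\<^sup>2 + 2 * \<kappa>\<^sup>2 * \<sigma>\<^sup>2 - C\<^sup>2 * (\<kappa>\<^sup>2 - 1))"
      using \<open>f * S = C\<close> by simp
    also have "\<dots> < 0"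
    proof -
      have "(\<kappa>\<^sup>2 - 1) * S\<^sup>2 + 2 * \<kappa>\<^sup>2 * \<sigma>\<^sup>2 = 2 * \<kappa>\<^sup>2 - (\<kappa>\<^sup>2 + 1) * S\<^sup>2"
        using S by algebra
      moreover have "(\<kappa>\<^sup>2 + 1) * S\<^sup>2 \<ge> 0" by simp
      ultimately show ?thesis using C \<open>C > 0\<close> by (intro mult_pos_neg) linarith+
    qed
    finally show ?thesis .
  qed
  ultimately have "M * M * ?L < 0"
    by (smt (verit) mult_pos_neg not_real_square_gt_zero)
  then show ?thesis using Mpos by (simp add: mult_less_0_iff)
qed


section \<open>A minimal surface does not touch a barrier from outside\<close>

lemma second_derivative_test:
  fixes \<phi> \<phi>' :: "real \<Rightarrow> real"
  assumes "0 < d" and \<phi>: "\<And>s. \<bar>s\<bar> < d \<Longrightarrow> (\<phi> has_real_derivative \<phi>' s) (at s)"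
    and \<phi>': "(\<phi>' has_real_derivative D) (at 0)"
    and min: "\<And>s. \<bar>s\<bar> < d \<Longrightarrow> \<phi> 0 \<le> \<phi> s"
  shows "\<phi>' 0 = 0" "D \<ge> 0"
proof -
  show *: "\<phi>' 0 = 0"
    using DERIV_local_min[OF \<phi>[of 0] \<open>0 < d\<close>] min \<open>0 < d\<close> by auto
  show "D \<ge> 0"
  proof (rule ccontr)
    assume "\<not> D \<ge> 0"
    then obtain r where r: "r > 0" "\<And>h. 0 < h \<Longrightarrow> h < r \<Longrightarrow> \<phi>' h < 0"
      using DERIV_neg_dec_right[OF \<phi>'] * by auto
    define s where "s = min r d / 2"
    have s: "0 < s" "s < r" "s < d" using r \<open>0 < d\<close> by (auto simp: s_def min_def)
    have "\<exists>x. 0 < x \<and> x < s \<and> \<phi> s - \<phi> 0 = (s - 0) * \<phi>' x"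
      using s by (intro MVT2 \<phi>) auto
    then obtain x where x: "0 < x" "x < s" "\<phi> s - \<phi> 0 = (s - 0) * \<phi>' x"
      by blast
    then have "\<phi> s < \<phi> 0" using r(2)[of x] s by (smt (verit) mult_pos_neg)
    then show False using min[of s] s by simp
  qed
qed

lemma dir_deriv_add_scale:
  assumes "F differentiable (at z)"
  shows "dir_deriv (x *\<^sub>R h + y *\<^sub>R k) F z = x *\<^sub>R dir_deriv h F z + y *\<^sub>R dir_deriv k F z"
proof -
  have "linear (frechet_derivative F (at z))"
    using assms frechet_derivative_works has_derivative_linear by blast
  then show ?thesis by (simp add: dir_deriv_def linear_add linear_scale)
qed

lemma dir_deriv_second_add_scale:
  fixes x y :: real and h k :: complex
  assumes C2: "C2_on F W" and "open W" "z \<in> W"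
  defines "l \<equiv> x *\<^sub>R h + y *\<^sub>R k"
  shows "dir_deriv l (dir_deriv l F) z = x\<^sup>2 *\<^sub>R dir_deriv h (dir_deriv h F) z
    + (2 * x * y) *\<^sub>R dir_deriv h (dir_deriv k F) z + y\<^sup>2 *\<^sub>R dir_deriv k (dir_deriv k F) z"
proof -
  have diff: "F differentiable (at v)" "dir_deriv h F differentiable (at v)" if "v \<in> W" for v h
    using C2 that unfolding C2_on_def by auto
  let ?G = "\<lambda>w. x *\<^sub>R dir_deriv h F w + y *\<^sub>R dir_deriv k F w"
  have G: "(?G has_derivative (\<lambda>v. x *\<^sub>R dir_deriv v (dir_deriv h F) z + y *\<^sub>R dir_deriv v (dir_deriv k F) z)) (at z)"
    unfolding dir_deriv_def[of _ "dir_deriv _ F"]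
    by (intro has_derivative_add has_derivative_scaleR_right)
       (use diff[OF \<open>z \<in> W\<close>] frechet_derivative_works in blast)+
  have "(dir_deriv l F has_derivative (\<lambda>v. x *\<^sub>R dir_deriv v (dir_deriv h F) z + y *\<^sub>R dir_deriv v (dir_deriv k F) z)) (at z)"
    by (rule has_derivative_transform_within_open[OF G \<open>open W\<close> \<open>z \<in> W\<close>])
       (simp add: l_def dir_deriv_add_scale diff)
  then have "frechet_derivative (dir_deriv l F) (at z)
      = (\<lambda>v. x *\<^sub>R dir_deriv v (dir_deriv h F) z + y *\<^sub>R dir_deriv v (dir_deriv k F) z)"
    by (rule frechet_derivative_at[symmetric])
  then have "dir_deriv l (dir_deriv l F) z
      = x *\<^sub>R dir_deriv l (dir_deriv h F) z + y *\<^sub>R dir_deriv l (dir_deriv k F) z"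
    by (simp add: dir_deriv_def)
  also have "\<dots> = x *\<^sub>R (x *\<^sub>R dir_deriv h (dir_deriv h F) z + y *\<^sub>R dir_deriv k (dir_deriv h F) z)
      + y *\<^sub>R (x *\<^sub>R dir_deriv h (dir_deriv k F) z + y *\<^sub>R dir_deriv k (dir_deriv k F) z)"
    unfolding l_def by (simp add: dir_deriv_add_scale diff \<open>z \<in> W\<close>)
  also have "dir_deriv k (dir_deriv h F) z = dir_deriv h (dir_deriv k F) z"
    by (rule dir_deriv_commute[OF C2 \<open>open W\<close> \<open>z \<in> W\<close>])
  finally show ?thesis
    by (simp add: scaleR_add_right algebra_simps power2_eq_square flip: scaleR_add_left)
qed

text \<open>At a contact point the differential of the barrier vanishes on the tangent plane, so its gradient
  is normal. Minimality then removes the covariant acceleration from the trace of the second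
  derivative of the barrier along the surface; only the trace of the Hessian remains. It is
  nonnegative at a local minimum, against \<open>tangential_trace_negative\<close>.\<close>

lemma no_interior_contact:
  assumes C2: "C2_on F W" and "open W" "z \<in> W" and H2R: "F z \<in> H2R"
    and inj: "inj (frechet_derivative F (at z))"
    and minimal: "\<And>N. unit_normal F z N \<Longrightarrow> mean_curvature F z N = 0"
    and p: "norm p < 1" and \<kappa>: "1 < \<kappa>" and C: "0 < C" "2 * \<kappa>\<^sup>2 < C\<^sup>2 * (\<kappa>\<^sup>2 - 1)"
    and contact: "barrier \<kappa> c p (F z) = C"
    and above: "eventually (\<lambda>w. C \<le> barrier \<kappa> c p (F w)) (nhds z)"
  shows False
proof -
  have diff: "F differentiable (at v)" "dir_deriv h F differentiable (at v)" if "v \<in> W" for v h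
    using C2 that unfolding C2_on_def by auto
  have "isCont F z" using diff(1)[OF \<open>z \<in> W\<close>] differentiable_imp_continuous_within by blast
  moreover have "open H2R" by (auto simp: H2R_def intro: open_Times)
  ultimately have "eventually (\<lambda>w. F w \<in> H2R) (nhds z)"
    using H2R by (metis isCont_def tendsto_at_iff_tendsto_nhds topological_tendstoD)
  moreover have "eventually (\<lambda>w. w \<in> W) (nhds z)"
    using \<open>open W\<close> \<open>z \<in> W\<close> by (rule eventually_nhds_in_open)
  ultimately have "eventually (\<lambda>w. C \<le> barrier \<kappa> c p (F w) \<and> F w \<in> H2R \<and> w \<in> W) (nhds z)"
    using above by eventually_elim auto
  then obtain e where e: "e > 0"
      "\<And>w. dist w z < e \<Longrightarrow> C \<le> barrier \<kappa> c p (F w) \<and> F w \<in> H2R \<and> w \<in> W"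
    unfolding eventually_nhds_metric by blast
  let ?b = "barrier_deriv \<kappa> c p (F z)" and ?Q = "barrier_hessian \<kappa> c p (F z)"
  let ?\<Gamma> = "H2R_christoffel (F z)"
  have line: "?b (dir_deriv h F z) = 0"
      "?Q (dir_deriv h F z) (dir_deriv h F z)
       + ?b (dir_deriv h (dir_deriv h F) z + ?\<Gamma> (dir_deriv h F z) (dir_deriv h F z)) \<ge> 0" for h
  proof -
    define d where "d = e / (norm h + 1)"
    have h1: "norm h + 1 > 0" by (smt (verit) norm_ge_zero)
    have "d > 0" using e h1 by (simp add: d_def)
    have near: "dist (z + s *\<^sub>R h) z < e" if "\<bar>s\<bar> < d" for s
    proof -
      have "dist (z + s *\<^sub>R h) z \<le> \<bar>s\<bar> * (norm h + 1)" by (simp add: dist_norm mult_left_mono)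
      also have "\<dots> < d * (norm h + 1)" using that h1 by simp
      finally show ?thesis using h1 by (simp add: d_def)
    qed
    note near_e = e(2)[OF near]
    let ?x = "\<lambda>s. F (z + s *\<^sub>R h)" and ?v = "\<lambda>s. dir_deriv h F (z + s *\<^sub>R h)"
    have dx: "(?x has_vector_derivative ?v s) (at s)" if "\<bar>s\<bar> < d" for s
      using near_e[OF that] by (intro line_has_vector_derivative diff) auto
    have dv: "(?v has_vector_derivative dir_deriv h (dir_deriv h F) (z + 0 *\<^sub>R h)) (at 0)"
      using \<open>z \<in> W\<close> by (intro line_has_vector_derivative diff) auto
    have 1: "((\<lambda>s. barrier \<kappa> c p (?x s)) has_real_derivative barrier_deriv \<kappa> c p (?x s) (?v s)) (at s)"
      if "\<bar>s\<bar> < d" for s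
      using near_e[OF that] by (intro barrier_derivative dx that) (auto simp: H2R_def)
    have 2: "((\<lambda>s. barrier_deriv \<kappa> c p (?x s) (?v s)) has_real_derivative
       barrier_hessian \<kappa> c p (?x 0) (?v 0) (?v 0) + barrier_deriv \<kappa> c p (?x 0)
         (dir_deriv h (dir_deriv h F) (z + 0 *\<^sub>R h) + H2R_christoffel (?x 0) (?v 0) (?v 0))) (at 0)"
      using H2R \<open>d > 0\<close> by (intro barrier_second_derivative dx dv) (auto simp: H2R_def)
    have 3: "barrier \<kappa> c p (?x 0) \<le> barrier \<kappa> c p (?x s)" if "\<bar>s\<bar> < d" for s
      using near_e[OF that] contact by simp
    show "?b (dir_deriv h F z) = 0"
      using second_derivative_test(1)[OF \<open>d > 0\<close> 1 2 3] by simp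
    show "?Q (dir_deriv h F z) (dir_deriv h F z)
       + ?b (dir_deriv h (dir_deriv h F) z + ?\<Gamma> (dir_deriv h F z) (dir_deriv h F z)) \<ge> 0"
      using second_derivative_test(2)[OF \<open>d > 0\<close> 1 2 3] by simp
  qed
  define \<zeta> where "\<zeta> = fst (F z)"
  have \<zeta>: "norm \<zeta> < 1" using H2R by (auto simp: H2R_def \<zeta>_def)
  define l where "l = hyp_factor \<zeta>"
  have l: "l > 0" using hyp_factor_inner(1)[OF \<zeta>] by (simp add: l_def)
  define u where "u = dir_deriv 1 F z"
  define v where "v = dir_deriv \<i> F z"
  let ?g = "H2R_metric (F z)"
  have g: "?g a b = l\<^sup>2 * (fst a \<bullet> fst b) + snd a * snd b" for a b
    by (simp add: H2R_metric_def l_def \<zeta>_def)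
  define E where "E = ?g u u"
  define G where "G = ?g v v"
  define M where "M = ?g u v"
  have gpos: "?g a a \<ge> 0" "?g a a = 0 \<Longrightarrow> a = 0" for a
  proof -
    show "?g a a \<ge> 0" unfolding g by simp
    assume "?g a a = 0"
    moreover have "l\<^sup>2 * (fst a \<bullet> fst a) \<ge> 0" "snd a * snd a \<ge> 0" by auto
    ultimately have "l\<^sup>2 * (fst a \<bullet> fst a) = 0" "snd a * snd a = 0" unfolding g by linarith+
    then show "a = 0" using l by (simp add: prod_eq_iff)
  qed
  have inj0: "h = 0" if "dir_deriv h F z = 0" for h
  proof -
    have "linear (frechet_derivative F (at z))"
      using diff \<open>z \<in> W\<close> frechet_derivative_works has_derivative_linear by blast
    then show ?thesis using that inj by (simp add: linear_injective_0 dir_deriv_def)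
  qed
  have "E \<noteq> 0" using gpos(2)[of u] inj0[of 1] by (auto simp: E_def u_def)
  then have E: "E > 0" using gpos(1)[of u] by (simp add: E_def)
  have det: "E * G - M\<^sup>2 > 0"
  proof -
    let ?a = "dir_deriv ((- M) *\<^sub>R 1 + E *\<^sub>R \<i>) F z"
    have a: "?a = (- M) *\<^sub>R u + E *\<^sub>R v"
      unfolding u_def v_def by (rule dir_deriv_add_scale) (use diff \<open>z \<in> W\<close> in auto)
    have "?g (x *\<^sub>R u + y *\<^sub>R v) (x *\<^sub>R u + y *\<^sub>R v) = x\<^sup>2 * E + 2 * x * y * M + y\<^sup>2 * G" for x y
      unfolding E_def G_def M_def g fst_add snd_add fst_scaleR snd_scaleR real_scaleR_def
        inner_add_left inner_add_right inner_scaleR_left inner_scaleR_right inner_commute[of "fst v" "fst u"]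
      by algebra
    from this[of "- M" E] have "?g ?a ?a = E * (E * G - M\<^sup>2)"
      unfolding a by (simp add: power2_eq_square algebra_simps)
    moreover have "?g ?a ?a \<noteq> 0"
    proof
      assume "?g ?a ?a = 0"
      then have "(- M) *\<^sub>R 1 + E *\<^sub>R \<i> = 0" using gpos(2) inj0 by blast
      then have "E = 0" by (simp add: complex_eq_iff)
      with E show False by simp
    qed
    ultimately have "E * (E * G - M\<^sup>2) > 0" using gpos(1)[of ?a] by linarith
    then show ?thesis using E by (simp add: zero_less_mult_iff)
  qed

  \<comment> \<open>the normalised Riemannian gradient of the barrier is a unit normal of the surface\<close>
  define S where "S = cos (\<kappa> * (snd (F z) - c))"
  define \<sigma> where "\<sigma> = sin (\<kappa> * (snd (F z) - c))"
  define f where "f = hyp_cosh p \<zeta>"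
  define gr where "gr = hyp_cosh_grad p \<zeta>"
  have b: "?b a = S * (gr \<bullet> fst a) - \<kappa> * \<sigma> * f * snd a" for a
    by (simp add: barrier_deriv_def S_def \<sigma>_def f_def gr_def \<zeta>_def)
  have fS: "f * S = C" using contact by (simp add: barrier_def f_def S_def \<zeta>_def)
  have S1: "S\<^sup>2 + \<sigma>\<^sup>2 = 1" by (simp add: S_def \<sigma>_def)
  have f1: "f \<ge> 1" unfolding f_def by (rule hyp_cosh_ge_1[OF p \<zeta>])
  have gr: "gr \<bullet> gr = l\<^sup>2 * (f\<^sup>2 - 1)"
    unfolding gr_def l_def f_def by (rule norm_hyp_cosh_grad[OF p \<zeta>])
  define n where "n = ((S / l\<^sup>2) *\<^sub>R gr, - (\<kappa> * \<sigma> * f))"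
  have gn: "?g n a = ?b a" for a
    unfolding g b n_def using l by simp
  define r where "r = sqrt (?g n n)"
  have "n \<noteq> 0"
  proof
    assume "n = 0"
    then have "(S / l\<^sup>2) *\<^sub>R gr = 0" "\<kappa> * \<sigma> * f = 0" by (auto simp: n_def prod_eq_iff)
    moreover have "S \<noteq> 0" using fS \<open>C > 0\<close> by auto
    ultimately have "gr = 0" "\<sigma> = 0" using l \<kappa> f1 by auto
    then have "f\<^sup>2 = 1" "S\<^sup>2 = 1" using gr l S1 by auto
    then have "C\<^sup>2 = 1" using fS by (auto simp: power_mult_distrib)
    then show False using C(2) by simp (smt (verit) zero_le_power2)
  qed
  then have "?g n n \<noteq> 0" using gpos(2) by blast
  then have "?g n n > 0" using gpos(1)[of n] by linarith
  then have r: "r > 0" "r\<^sup>2 = ?g n n" by (auto simp: r_def)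
  define N where "N = (1 / r) *\<^sub>R n"
  have gN: "?g a N = ?b a / r" for a
    unfolding N_def gn[symmetric] g by (simp add: inner_commute add_divide_distrib)
  have "?g N N = 1"
  proof -
    have "?g N N = ?g n n / (r * r)" unfolding gN unfolding N_def gn[symmetric] g by (simp add: add_divide_distrib)
    then show ?thesis using r(2) \<open>?g n n > 0\<close> by (simp add: power2_eq_square)
  qed
  moreover have "?g N (dir_deriv h F z) = 0" for h
  proof -
    have "?g N (dir_deriv h F z) = ?g (dir_deriv h F z) N" unfolding g by (simp add: inner_commute)
    then show ?thesis unfolding gN line(1) by simp
  qed
  ultimately have "unit_normal F z N" by (simp add: unit_normal_def)
  from minimal[OF this] have H0: "mean_curvature F z N = 0" .
  define b11 where "b11 = ?b (dir_deriv 1 (dir_deriv 1 F) z + ?\<Gamma> u u)"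
  define b12 where "b12 = ?b (dir_deriv 1 (dir_deriv \<i> F) z + ?\<Gamma> u v)"
  define b22 where "b22 = ?b (dir_deriv \<i> (dir_deriv \<i> F) z + ?\<Gamma> v v)"
  have "E * (b22 / r) - 2 * M * (b12 / r) + G * (b11 / r) = 0"
    using H0 det
    unfolding mean_curvature_def first_form_def second_form_def gN u_def[symmetric] v_def[symmetric]
      E_def[symmetric] G_def[symmetric] M_def[symmetric] b11_def[symmetric] b12_def[symmetric] b22_def[symmetric]
    by simp
  moreover have "E * (b22 / r) - 2 * M * (b12 / r) + G * (b11 / r) = (E * b22 - 2 * M * b12 + G * b11) / r"
    by (simp add: add_divide_distrib diff_divide_distrib)
  ultimately have H: "E * b22 - 2 * M * b12 + G * b11 = 0" using r by simp

  \<comment> \<open>second derivative of the barrier on the surface in direction \<open>x + y \<i>\<close>; the mixed term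
      combines both mixed derivatives of \<open>F\<close>\<close>
  have form: "x\<^sup>2 * (?Q u u + b11) + 2 * x * y * (?Q u v + b12) + y\<^sup>2 * (?Q v v + b22) \<ge> 0" for x y
  proof -
    let ?h = "x *\<^sub>R 1 + y *\<^sub>R \<i>"
    have 1: "dir_deriv ?h F z = x *\<^sub>R u + y *\<^sub>R v"
      unfolding u_def v_def by (rule dir_deriv_add_scale) (use diff \<open>z \<in> W\<close> in auto)
    have 2: "?Q (x *\<^sub>R u + y *\<^sub>R v) (x *\<^sub>R u + y *\<^sub>R v)
        = x\<^sup>2 * ?Q u u + 2 * x * y * ?Q u v + y\<^sup>2 * ?Q v v"
      unfolding barrier_hessian_def fst_add snd_add fst_scaleR snd_scaleR real_scaleR_def
        inner_add_left inner_add_right inner_scaleR_left inner_scaleR_right inner_commute[of "fst v" "fst u"]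
      by algebra
    have 3: "?\<Gamma> (x *\<^sub>R u + y *\<^sub>R v) (x *\<^sub>R u + y *\<^sub>R v)
        = x\<^sup>2 *\<^sub>R ?\<Gamma> u u + (2 * x * y) *\<^sub>R ?\<Gamma> u v + y\<^sup>2 *\<^sub>R ?\<Gamma> v v"
      by (simp add: H2R_christoffel_def prod_eq_iff complex_eq_iff inner_complex_def power2_eq_square algebra_simps)
    have badd: "?b (a + a') = ?b a + ?b a'" "?b (t *\<^sub>R a) = t * ?b a" for a a' t
      unfolding b by (simp_all add: inner_add_right algebra_simps)
    have "?Q (dir_deriv ?h F z) (dir_deriv ?h F z)
       + ?b (dir_deriv ?h (dir_deriv ?h F) z + ?\<Gamma> (dir_deriv ?h F z) (dir_deriv ?h F z)) \<ge> 0"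
      by (rule line(2))
    also have "?Q (dir_deriv ?h F z) (dir_deriv ?h F z)
       + ?b (dir_deriv ?h (dir_deriv ?h F) z + ?\<Gamma> (dir_deriv ?h F z) (dir_deriv ?h F z))
       = x\<^sup>2 * (?Q u u + b11) + 2 * x * y * (?Q u v + b12) + y\<^sup>2 * (?Q v v + b22)"
      unfolding 1 2 3 dir_deriv_second_add_scale[OF C2 \<open>open W\<close> \<open>z \<in> W\<close>] b11_def b12_def b22_def badd
      by (simp add: algebra_simps)
    finally show ?thesis .
  qed
  \<comment> \<open>the trace of a nonnegative form, from its values at \<open>(1, 0)\<close> and at the vector \<open>(-M, E)\<close>
      orthogonal to it in the first fundamental form\<close>
  have "?Q u u + b11 \<ge> 0" using form[of 1 0] by simp
  then have "(E * G - M\<^sup>2) * (?Q u u + b11) \<ge> 0" using det by simp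
  moreover have "E * (E * ?Q v v - 2 * M * ?Q u v + G * ?Q u u)
      = ((-M)\<^sup>2 * (?Q u u + b11) + 2 * (-M) * E * (?Q u v + b12) + E\<^sup>2 * (?Q v v + b22))
        + (E * G - M\<^sup>2) * (?Q u u + b11)"
    using H by algebra
  ultimately have "E * (E * ?Q v v - 2 * M * ?Q u v + G * ?Q u u) \<ge> 0"
    using form[of "-M" E] by linarith
  then have nonneg: "E * ?Q v v - 2 * M * ?Q u v + G * ?Q u u \<ge> 0"
    using E by (simp add: zero_le_mult_iff)

  \<comment> \<open>orthonormal coordinates: the disk components are multiplied by the conformal factor \<open>l\<close>\<close>
  define q where "q = (\<lambda>u1 u2 u3 v1 v2 v3. f * S * (u1 * v1 + u2 * v2)
      - \<kappa> * \<sigma> * ((Re gr / l * u1 + Im gr / l * u2) * v3 + (Re gr / l * v1 + Im gr / l * v2) * u3)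
      - \<kappa>\<^sup>2 * f * S * u3 * (v3::real))"
  have Q: "?Q a d = q (l * Re (fst a)) (l * Im (fst a)) (snd a) (l * Re (fst d)) (l * Im (fst d)) (snd d)" for a d
    unfolding barrier_hessian_def q_def \<zeta>_def[symmetric] l_def[symmetric] f_def[symmetric] gr_def[symmetric]
      S_def[symmetric] \<sigma>_def[symmetric] inner_complex_def using l
    by (simp add: power2_eq_square algebra_simps)
  have gc: "?g a d = (l * Re (fst a)) * (l * Re (fst d)) + (l * Im (fst a)) * (l * Im (fst d)) + snd a * snd d" for a d
    unfolding g inner_complex_def by (simp add: power2_eq_square algebra_simps)
  have "E * ?Q v v - 2 * M * ?Q u v + G * ?Q u u < 0"
    unfolding Q E_def M_def G_def gc
  proof (rule tangential_trace_negative[where S = S and \<sigma> = \<sigma> and f = f and \<kappa> = \<kappa> and C = C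
        and da = "Re gr / l" and db = "Im gr / l"])
    show "(Re gr / l)\<^sup>2 + (Im gr / l)\<^sup>2 = f\<^sup>2 - 1"
      using gr l by (simp add: inner_complex_def power2_eq_square field_simps)
    show "S * (Re gr / l * (l * Re (fst u)) + Im gr / l * (l * Im (fst u))) - \<kappa> * \<sigma> * f * snd u = 0"
      using line(1)[of 1] l unfolding b u_def[symmetric] by (simp add: inner_complex_def)
    show "S * (Re gr / l * (l * Re (fst v)) + Im gr / l * (l * Im (fst v))) - \<kappa> * \<sigma> * f * snd v = 0"
      using line(1)[of \<i>] l unfolding b v_def[symmetric] by (simp add: inner_complex_def)
  qed (use det S1 fS \<kappa> C in \<open>simp_all add: q_def E_def M_def G_def gc\<close>)
  with nonneg show False by simp
qed


section \<open>Sliding the axis of the barrier\<close>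

text \<open>Clearing denominators gives an inequality between functions that are continuous up to the circle at infinity,
  where the barrier itself tends to infinity. This is what makes compactness available in the next lemma.\<close>

lemma barrier_contact_iff:
  fixes k :: "complex \<times> real"
  assumes "norm p < 1" "norm (fst k) < 1"
  shows "barrier \<kappa> c p k \<le> C \<longleftrightarrow>
    ((1 - (norm p)\<^sup>2) * (1 - (norm (fst k))\<^sup>2) + 2 * (norm (fst k - p))\<^sup>2) * cos (\<kappa> * (snd k - c))
      \<le> C * ((1 - (norm p)\<^sup>2) * (1 - (norm (fst k))\<^sup>2))"
proof -
  define D where "D = (1 - (norm p)\<^sup>2) * (1 - (norm (fst k))\<^sup>2)"
  have "D > 0" unfolding D_def using assms by (intro mult_pos_pos) (auto simp: abs_square_less_1)
  moreover have "barrier \<kappa> c p k = (D + 2 * (norm (fst k - p))\<^sup>2) * cos (\<kappa> * (snd k - c)) / D"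
    unfolding barrier_def hyp_cosh_eq[OF assms] D_def[symmetric] using \<open>D > 0\<close>
    by (simp add: field_simps)
  ultimately show ?thesis unfolding D_def[symmetric] by (simp add: divide_le_eq)
qed

text \<open>The times at which the solid \<open>{w \<le> C}\<close> meets \<open>K\<close> form a compact set, so there is a first one. Before it the
  barrier exceeds \<open>C\<close> on \<open>K\<close>, hence at that time it is at least \<open>C\<close> by continuity, with equality at a contact point.\<close>

lemma first_contact:
  fixes K :: "(complex \<times> real) set" and p :: "real \<Rightarrow> complex"
  assumes K: "compact K" "K \<subseteq> H2R_closed" and cos: "\<And>k. k \<in> K \<Longrightarrow> 0 < cos (\<kappa> * (snd k - c))"
    and p: "continuous_on {0..1} p" "\<And>s. s \<in> {0..1} \<Longrightarrow> norm (p s) < 1"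
    and start: "\<And>k. k \<in> K \<Longrightarrow> norm (fst k) < 1 \<Longrightarrow> C < barrier \<kappa> c (p 0) k"
    and stop: "k1 \<in> K" "norm (fst k1) < 1" "barrier \<kappa> c (p 1) k1 \<le> C"
  obtains s k where "s \<in> {0..1}" "k \<in> K" "norm (fst k) < 1" "barrier \<kappa> c (p s) k = C"
    "\<And>k'. k' \<in> K \<Longrightarrow> norm (fst k') < 1 \<Longrightarrow> C \<le> barrier \<kappa> c (p s) k'"
proof -
  define g where "g = (\<lambda>(s, k :: complex \<times> real). C * ((1 - (norm (p s))\<^sup>2) * (1 - (norm (fst k))\<^sup>2))
    - ((1 - (norm (p s))\<^sup>2) * (1 - (norm (fst k))\<^sup>2) + 2 * (norm (fst k - p s))\<^sup>2) * cos (\<kappa> * (snd k - c)))"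
  have pc: "continuous_on ({0..1} \<times> K) (\<lambda>x. p (fst x))"
    by (rule continuous_on_compose2[OF p(1)]) (auto intro: continuous_intros)
  have gc: "continuous_on ({0..1} \<times> K) g"
    unfolding g_def case_prod_beta by (intro continuous_intros pc)
  have g: "barrier \<kappa> c (p s) k \<le> C \<longleftrightarrow> 0 \<le> g (s, k)" if "s \<in> {0..1}" "norm (fst k) < 1" for s k
    using barrier_contact_iff[OF p(2)[OF that(1)] that(2), of \<kappa> c C] by (simp add: g_def)
  \<comment> \<open>on the circle at infinity the cleared contact inequality reads \<open>positive \<le> 0\<close>\<close>
  have inside: "norm (fst k) < 1" if "s \<in> {0..1}" "k \<in> K" "0 \<le> g (s, k)" for s k
  proof (rule ccontr)
    assume "\<not> norm (fst k) < 1"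
    then have 1: "norm (fst k) = 1" using K(2) that(2) by (auto simp: H2R_closed_def)
    then have "fst k \<noteq> p s" using p(2)[OF that(1)] by auto
    then have "2 * (norm (fst k - p s))\<^sup>2 * cos (\<kappa> * (snd k - c)) > 0" using cos[OF that(2)] by simp
    then show False using that(3) 1 by (simp add: g_def)
  qed
  define B where "B = {x \<in> {0..1} \<times> K. 0 \<le> g x}"
  have "compact ({0..1::real} \<times> K)" using K by (intro compact_Times) auto
  then have "compact B" unfolding B_def
    using continuous_closedin_preimage[OF gc, of "{0..}"]
    by (simp add: closedin_compact vimage_def Int_def Collect_conj_eq[symmetric] conj_commute)
  then have cB: "compact (fst ` B)" by (intro compact_continuous_image continuous_intros)
  have "(1, k1) \<in> B" using stop g by (simp add: B_def)
  then have "fst ` B \<noteq> {}" by blast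
  then obtain s where s: "s \<in> fst ` B" "\<And>s'. s' \<in> fst ` B \<Longrightarrow> s \<le> s'"
    using compact_attains_inf[OF cB] by blast
  then obtain k where k: "(s, k) \<in> B" by auto
  have sI: "s \<in> {0..1}" "k \<in> K" "0 \<le> g (s, k)" using k by (auto simp: B_def)
  have "s \<noteq> 0"
    using start[of k] g[of s k] sI inside[OF sI] by auto
  then have "0 < s" using sI by auto
  have neg: "g (s, k') \<le> 0" if "k' \<in> K" for k'
  proof (rule tendsto_upperbound)
    have "continuous_on {0..s} (\<lambda>s'. g (s', k'))"
      by (rule continuous_on_compose2[OF gc]) (use sI that in \<open>auto intro!: continuous_intros\<close>)
    then have "((\<lambda>s'. g (s', k')) \<longlongrightarrow> g (s, k')) (at s within {0..s})"
      using \<open>0 < s\<close> by (auto simp: continuous_on_def)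
    then show "((\<lambda>s'. g (s', k')) \<longlongrightarrow> g (s, k')) (at_left s)"
      using \<open>0 < s\<close> by (simp add: at_within_Icc_at_left)
    have "g (s', k') \<le> 0" if "s' \<in> {0<..<s}" for s'
    proof (rule ccontr)
      assume "\<not> g (s', k') \<le> 0"
      then have "(s', k') \<in> B" using that sI \<open>k' \<in> K\<close> by (auto simp: B_def)
      then have "s \<le> s'" using s(2) by force
      then show False using that by simp
    qed
    then show "\<forall>\<^sub>F s' in at_left s. g (s', k') \<le> 0"
      using eventually_at_left_real[OF \<open>0 < s\<close>] by (rule eventually_mono[rotated])
  qed simp
  have D: "0 < (1 - (norm (p s))\<^sup>2) * (1 - (norm (fst k'))\<^sup>2)" if "norm (fst k') < 1" for k' :: "complex \<times> real"
    using that p(2)[OF sI(1)] by (intro mult_pos_pos) (auto simp: abs_square_less_1)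
  have gB: "g (s, k') = (C - barrier \<kappa> c (p s) k') * ((1 - (norm (p s))\<^sup>2) * (1 - (norm (fst k'))\<^sup>2))"
    if "norm (fst k') < 1" for k'
    unfolding g_def barrier_def hyp_cosh_eq[OF p(2)[OF sI(1)] that] using D[OF that]
    by (simp add: field_simps)
  have above: "C \<le> barrier \<kappa> c (p s) k'" if "k' \<in> K" "norm (fst k') < 1" for k'
  proof (rule ccontr)
    assume "\<not> C \<le> barrier \<kappa> c (p s) k'"
    then have "0 < g (s, k')" unfolding gB[OF that(2)] by (intro mult_pos_pos[OF _ D[OF that(2)]]) auto
    then show False using neg[OF that(1)] by simp
  qed
  moreover have "barrier \<kappa> c (p s) k \<le> C" using g[of s k] sI inside[OF sI] by simp
  ultimately show ?thesis using that[of s k] sI inside[OF sI] by (meson order_antisym)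
qed

text \<open>A contact point has bounded hyperbolic distance from the axis. In the Euclidean metric this is a
  small distance when \<open>p\<close> is near the circle at infinity.\<close>

lemma contact_near_centre:
  assumes "norm p < 1" "norm (fst k) < 1" "barrier \<kappa> c p k \<le> C" "0 < \<eta>" "\<eta> \<le> cos (\<kappa> * (snd k - c))"
  shows "(dist (fst k) p)\<^sup>2 \<le> C / \<eta> * (1 - norm p)"
proof -
  define h where "h = hyp_cosh p (fst k)"
  have "h \<ge> 1" unfolding h_def by (rule hyp_cosh_ge_1[OF assms(1,2)])
  then have "h * \<eta> \<le> C" using assms(3,5) unfolding barrier_def h_def[symmetric]
    by (smt (verit, best) mult_left_mono)
  then have hC: "h \<le> C / \<eta>" using assms(4) by (simp add: field_simps)
  have P: "1 - (norm p)\<^sup>2 > 0" "1 - (norm (fst k))\<^sup>2 > 0"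
    using assms(1,2) by (auto simp: abs_square_less_1)
  have eq: "2 * (norm (fst k - p))\<^sup>2 = (h - 1) * ((1 - (norm p)\<^sup>2) * (1 - (norm (fst k))\<^sup>2))"
    unfolding h_def hyp_cosh_eq[OF assms(1,2)] using P by simp
  also have "\<dots> \<le> (C / \<eta>) * ((1 - (norm p)\<^sup>2) * 1)"
    using P hC \<open>h \<ge> 1\<close> by (intro mult_mono) auto
  also have "\<dots> \<le> (C / \<eta>) * (2 * (1 - norm p))"
  proof (rule mult_left_mono)
    show "(1 - (norm p)\<^sup>2) * 1 \<le> 2 * (1 - norm p)"
      using zero_le_power2[of "1 - norm p"] by (simp add: power2_eq_square algebra_simps)
  qed (use hC \<open>h \<ge> 1\<close> in linarith)
  also have "\<dots> = 2 * (C / \<eta> * (1 - norm p))" by (rule mult.left_commute)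
  finally show ?thesis by (simp add: dist_norm)
qed

text \<open>The two hypotheses \<open>free\<close> and \<open>approach\<close> provide a starting position without contact and a final one
  with contact. The axis moves along a segment near \<open>q\<close>: a point within \<open>r2\<close> of \<open>q\<close> has
  distance at most \<open>r2\<close> from the circle, so \<open>contact_near_centre\<close> applies uniformly and
  keeps all contact points within \<open>r\<close> of \<open>q\<close>.\<close>

lemma sliding_barrier_contact:
  fixes K :: "(complex \<times> real) set"
  assumes K: "compact K" "K \<subseteq> H2R_closed" and q: "norm q = 1" and "0 < r" and "0 < \<epsilon>" "\<epsilon> < pi / 2"
    and height: "\<And>k. k \<in> K \<Longrightarrow> \<bar>snd k - c\<bar> \<le> pi / 2 - \<epsilon>"
    and free: "\<And>\<delta>. 0 < \<delta> \<Longrightarrow> \<exists>a. norm a = 1 \<and> dist a q < \<delta> \<and> a \<notin> fst ` K"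
    and approach: "\<And>\<delta>. 0 < \<delta> \<Longrightarrow> \<exists>k\<in>K. norm (fst k) < 1 \<and> dist (fst k) q < \<delta>"
  obtains \<kappa> C p k where "1 < \<kappa>" "0 < C" "2 * \<kappa>\<^sup>2 < C\<^sup>2 * (\<kappa>\<^sup>2 - 1)" "norm p < 1"
    "k \<in> K" "norm (fst k) < 1" "dist (fst k) q < r" "barrier \<kappa> c p k = C"
    "\<And>k'. k' \<in> K \<Longrightarrow> norm (fst k') < 1 \<Longrightarrow> C \<le> barrier \<kappa> c p k'"
proof -
  \<comment> \<open>\<open>\<kappa> > 1\<close> is chosen so close to 1 that the cosine stays above a positive \<open>\<eta>\<close> on the slab\<close>
  define \<kappa> where "\<kappa> = (pi / 2 - \<epsilon> / 2) / (pi / 2 - \<epsilon>)"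
  have \<kappa>: "1 < \<kappa>" using \<open>0 < \<epsilon>\<close> \<open>\<epsilon> < pi / 2\<close> by (simp add: \<kappa>_def)
  define \<eta> where "\<eta> = cos (pi / 2 - \<epsilon> / 2)"
  have \<eta>: "0 < \<eta>" unfolding \<eta>_def using \<open>0 < \<epsilon>\<close> \<open>\<epsilon> < pi / 2\<close> by (intro cos_gt_zero) auto
  have cos: "\<eta> \<le> cos (\<kappa> * (snd k - c))" if "k \<in> K" for k
  proof -
    have "\<bar>\<kappa> * (snd k - c)\<bar> \<le> \<kappa> * (pi / 2 - \<epsilon>)"
      using height[OF that] \<kappa> by (simp add: abs_mult)
    also have "\<dots> = pi / 2 - \<epsilon> / 2" using \<open>\<epsilon> < pi / 2\<close> by (simp add: \<kappa>_def)
    finally have "\<bar>\<kappa> * (snd k - c)\<bar> \<le> pi / 2 - \<epsilon> / 2" .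
    then have "cos (pi / 2 - \<epsilon> / 2) \<le> cos \<bar>\<kappa> * (snd k - c)\<bar>"
      using \<open>0 < \<epsilon>\<close> by (intro cos_monotone_0_pi_le) (auto simp: field_simps)
    then show ?thesis by (simp add: \<eta>_def)
  qed
  define C where "C = 2 * \<kappa>\<^sup>2 / (\<kappa>\<^sup>2 - 1) + 2"
  have k1: "\<kappa>\<^sup>2 - 1 > 0" using \<kappa> by simp
  then have "2 * \<kappa>\<^sup>2 / (\<kappa>\<^sup>2 - 1) \<ge> 0" by (intro divide_nonneg_pos) auto
  then have C: "1 < C" by (simp add: C_def)
  have C2: "2 * \<kappa>\<^sup>2 < C\<^sup>2 * (\<kappa>\<^sup>2 - 1)"
  proof -
    have "C * (\<kappa>\<^sup>2 - 1) = 2 * \<kappa>\<^sup>2 + 2 * (\<kappa>\<^sup>2 - 1)" using k1 by (simp add: C_def field_simps)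
    then have "2 * \<kappa>\<^sup>2 < C * (\<kappa>\<^sup>2 - 1)" using k1 by simp
    also have "\<dots> \<le> C\<^sup>2 * (\<kappa>\<^sup>2 - 1)" using C k1 by (intro mult_right_mono) (auto simp: power2_eq_square)
    finally show ?thesis .
  qed
  define B where "B = C / \<eta>"
  have B: "B > 0" using C \<eta> by (simp add: B_def)
  \<comment> \<open>admissible distances from \<open>p\<close> to the circle for contacts within \<open>d / 3\<close> of \<open>p\<close>\<close>
  have small: "\<exists>\<tau>>0. \<tau> \<le> d / 3 \<and> B * \<tau> \<le> (d / 3)\<^sup>2" if "d > 0" for d
  proof (intro exI[of _ "min (d / 3) ((d / 3)\<^sup>2 / B)"] conjI)
    show "B * min (d / 3) ((d / 3)\<^sup>2 / B) \<le> (d / 3)\<^sup>2"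
      using B by (metis min.cobounded2 mult.commute pos_le_divide_eq)
    show "min (d / 3) ((d / 3)\<^sup>2 / B) \<le> d / 3" by (rule min.cobounded1)
  qed (use that B in auto)
  have near: "dist (fst k) p \<le> d / 3"
    if "k \<in> K" "norm (fst k) < 1" "norm p < 1" "barrier \<kappa> c p k \<le> C" "1 - norm p \<le> \<tau>"
      "B * \<tau> \<le> (d / 3)\<^sup>2" "d > 0" for k p \<tau> d
  proof -
    have "(dist (fst k) p)\<^sup>2 \<le> B * (1 - norm p)"
      unfolding B_def by (rule contact_near_centre[OF that(3,2,4) \<eta> cos[OF that(1)]])
    also have "\<dots> \<le> B * \<tau>" using that B by simp
    also have "\<dots> \<le> (d / 3)\<^sup>2" by fact
    finally have "(dist (fst k) p)\<^sup>2 \<le> (d / 3)\<^sup>2" .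
    then show ?thesis by (rule power2_le_imp_le) (use that(7) in simp)
  qed
  obtain r2 where r2: "r2 > 0" "r2 \<le> r / 3" "B * r2 \<le> (r / 3)\<^sup>2" using small[OF \<open>0 < r\<close>] by blast
  obtain k1 where k1: "k1 \<in> K" "norm (fst k1) < 1" "dist (fst k1) q < r2"
    using approach[OF r2(1)] by blast
  obtain a where a: "norm a = 1" "dist a q < r2" "a \<notin> fst ` K" using free[OF r2(1)] by blast
  have "closed (fst ` K)"
    using K by (intro compact_imp_closed compact_continuous_image continuous_intros)
  then obtain d where d: "d > 0" "\<And>x. x \<in> fst ` K \<Longrightarrow> d \<le> dist a x"
    using separate_point_closed[OF _ a(3)] by blast
  obtain \<tau>1 where \<tau>1: "\<tau>1 > 0" "\<tau>1 \<le> d / 3" "B * \<tau>1 \<le> (d / 3)\<^sup>2" using small[OF d(1)] by blast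
  define \<tau> where "\<tau> = min \<tau>1 (min (1/2) ((r2 - dist a q) / 2))"
  have \<tau>: "0 < \<tau>" "\<tau> < 1" "\<tau> \<le> \<tau>1" "\<tau> < r2 - dist a q"
    using \<tau>1 a by (auto simp: \<tau>_def min_def)
  \<comment> \<open>the starting point; contacts there would be within \<open>2 d / 3\<close> of \<open>a\<close>\<close>
  define A where "A = (1 - \<tau>) *\<^sub>R a"
  have "A - a = - (\<tau> *\<^sub>R a)" by (simp add: A_def scaleR_diff_left)
  then have A: "norm A = 1 - \<tau>" "dist A a = \<tau>"
    using a(1) \<tau> by (simp_all add: A_def dist_norm)
  then have "dist A q < r2" using \<tau> dist_triangle[of A q a] by simp
  define p where "p = linepath A (fst k1)"
  have p_in: "p s \<in> ball 0 1 \<inter> ball q r2" if "s \<in> {0..1}" for s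
  proof -
    have "closed_segment A (fst k1) \<subseteq> ball 0 1 \<inter> ball q r2"
      using A \<tau> k1 \<open>dist A q < r2\<close>
      by (intro closed_segment_subset) (auto simp: convex_Int dist_commute)
    then show ?thesis using that unfolding p_def
      by (metis linepath_in_path path_image_linepath subset_eq)
  qed
  have start: "C < barrier \<kappa> c (p 0) k" if "k \<in> K" "norm (fst k) < 1" for k
  proof (rule ccontr)
    assume "\<not> C < barrier \<kappa> c (p 0) k"
    then have "dist (fst k) A \<le> d / 3"
      using near[of k A \<tau>1 d] that A \<tau> \<tau>1 d by (simp add: p_def linepath_0')
    then have "dist a (fst k) \<le> d / 3 + d / 3"
      using dist_triangle[of a "fst k" A] A \<tau> \<tau>1 by (simp add: dist_commute)
    then show False using d(2)[of "fst k"] that \<open>d > 0\<close> by auto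
  qed
  have stop: "barrier \<kappa> c (p 1) k1 \<le> C"
  proof -
    have "hyp_cosh (fst k1) (fst k1) = 1" using hyp_cosh_eq[OF k1(2) k1(2)] by simp
    then have "barrier \<kappa> c (p 1) k1 = cos (\<kappa> * (snd k1 - c))"
      by (simp add: p_def linepath_1' barrier_def)
    then show ?thesis using C cos_le_one[of "\<kappa> * (snd k1 - c)"] by linarith
  qed
  have pc: "continuous_on {0..1} p" unfolding p_def by (rule continuous_on_linepath)
  have pn: "norm (p s) < 1" if "s \<in> {0..1}" for s using p_in[OF that] by simp
  have cos0: "0 < cos (\<kappa> * (snd k - c))" if "k \<in> K" for k using cos[OF that] \<eta> by simp
  obtain s k where sk: "s \<in> {0..1}" "k \<in> K" "norm (fst k) < 1" "barrier \<kappa> c (p s) k = C"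
      "\<And>k'. k' \<in> K \<Longrightarrow> norm (fst k') < 1 \<Longrightarrow> C \<le> barrier \<kappa> c (p s) k'"
    using first_contact[OF K cos0 pc pn start k1(1,2) stop] by blast
  have ps: "dist (p s) q < r2" "norm (p s) < 1" using p_in[OF sk(1)] by (auto simp: dist_commute)
  have "1 - norm (p s) \<le> r2"
    using norm_triangle_ineq2[of q "p s"] q ps by (simp add: dist_norm norm_minus_commute)
  then have "dist (fst k) (p s) \<le> r / 3"
    using near[OF sk(2,3) ps(2), of r2 r] sk(4) r2 \<open>0 < r\<close> by simp
  then have "dist (fst k) q < r"
    using dist_triangle[of "fst k" q "p s"] ps r2 \<open>0 < r\<close> by simp
  then show ?thesis using that[of \<kappa> C "p s" k] sk \<kappa> C C2 ps by simp
qed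


section \<open>Points over a proper arc, and interior points of charts\<close>

text \<open>If the arc covered a neighbourhood of its end point \<open>q\<close> in the circle, then the inverse of its
  parametrisation would map an open interval of angles homeomorphically onto an open set of reals that contains
  the end point of \<open>[0, 1]\<close> but is contained in \<open>[0, 1]\<close>.\<close>

lemma one_side_free_point:
  assumes "one_side_of_vertical_line q A" "norm q = 1" "0 < \<delta>"
  shows "\<exists>a. norm a = 1 \<and> dist a q < \<delta> \<and> a \<notin> fst ` A"
proof (rule ccontr)
  assume "\<not> ?thesis"
  then have near: "a \<in> fst ` A" if "norm a = 1" "dist a q < \<delta>" for a using that by blast
  obtain c0 where c0: "arc c0" "q \<in> {pathstart c0, pathfinish c0}" "fst ` A \<subseteq> path_image c0"
    using assms(1) unfolding one_side_of_vertical_line_def by blast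
  obtain c where c: "arc c" "pathstart c = q" "fst ` A \<subseteq> path_image c"
  proof (cases "pathstart c0 = q")
    case True
    then show ?thesis using that[of c0] c0 by auto
  next
    case False
    then show ?thesis using that[of "reversepath c0"] c0 by (auto simp: arc_reversepath)
  qed
  obtain h where h: "homeomorphism {0..1} (path_image c) c h" using homeomorphism_arc[OF c(1)] by blast
  have "isCont (\<lambda>\<theta>. q * cis \<theta>) 0" unfolding cis_conv_exp by (intro continuous_intros)
  then obtain d where d: "d > 0" "\<And>\<theta>. dist \<theta> 0 < d \<Longrightarrow> dist (q * cis \<theta>) (q * cis 0) < \<delta>"
    using \<open>0 < \<delta>\<close> unfolding continuous_at_eps_delta by blast
  define J where "J = {- min d 1 <..< min d 1}"
  have Jo: "open J" by (simp add: J_def)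
  have onc: "q * cis \<theta> \<in> path_image c" if "\<theta> \<in> J" for \<theta>
  proof -
    have "dist \<theta> 0 < d" using that unfolding J_def dist_real_def greaterThanLessThan_iff by linarith
    then have "dist (q * cis \<theta>) q < \<delta>" using d(2)[of \<theta>] by simp
    moreover have "norm (q * cis \<theta>) = 1" using assms(2) by (simp add: norm_mult)
    ultimately show ?thesis using near c(3) by blast
  qed
  let ?k = "\<lambda>\<theta>. h (q * cis \<theta>)"
  have "continuous_on J (\<lambda>\<theta>. q * cis \<theta>)"
    unfolding cis_conv_exp by (intro continuous_intros)
  then have "continuous_on J ?k"
    by (rule continuous_on_compose2[OF homeomorphism_cont2[OF h]]) (use onc in blast)
  moreover have "inj_on ?k J"
  proof (rule inj_onI)
    fix x y assume xy: "x \<in> J" "y \<in> J" "?k x = ?k y"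
    then have "c (?k x) = c (?k y)" by simp
    then have "q * cis x = q * cis y"
      using homeomorphism_apply2[OF h] onc xy(1,2) by simp
    then have "cis x = cis y" using assms(2) by auto
    then have "sin x = sin y" by (metis cis.sel(2))
    then show "x = y"
      by (rule sin_inj_pi[rotated 4]) (use xy(1,2) pi_gt3 in \<open>unfold J_def greaterThanLessThan_iff, linarith+\<close>)
  qed
  ultimately have "open (?k ` J)" by (rule invariance_of_domain[OF _ Jo])
  moreover have "0 \<in> ?k ` J"
  proof
    show "(0::real) \<in> J" using d by (simp add: J_def)
    have "c 0 = q" using c by (simp add: pathstart_def)
    then show "0 = ?k 0" using homeomorphism_apply1[OF h, of 0] by simp
  qed
  ultimately obtain e where e: "e > 0" "ball 0 e \<subseteq> ?k ` J" by (auto elim: openE)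
  \<comment> \<open>\<open>q\<close> has parameter 0, so a negative parameter would occur\<close>
  have "- (e / 2) \<in> ball 0 e" using e(1) by simp
  then have "- (e / 2) \<in> ?k ` J" using e(2) by blast
  moreover have "?k ` J \<subseteq> {0..1}" using onc h unfolding homeomorphism_def by blast
  ultimately have "- (e / 2) \<in> {0..1}" by blast
  then show False using e(1) by simp
qed

lemma local_parametrisation_inverse:
  assumes "local_parametrisation S U V \<psi>"
  obtains \<phi> where "continuous_map (top_of_set U) (subtopology S V) \<psi>"
    "continuous_map (subtopology S V) (top_of_set U) \<phi>"
    "\<And>w. w \<in> U \<Longrightarrow> \<phi> (\<psi> w) = w" "\<And>p. p \<in> V \<Longrightarrow> \<psi> (\<phi> p) = p"
    "\<psi> ` U = V" "\<phi> ` V = U" "V \<subseteq> topspace S" "openin S V" "U \<subseteq> half_plane"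
proof -
  have V: "openin S V" using assms by (simp add: local_parametrisation_def)
  have VS: "V \<subseteq> topspace S" by (rule openin_subset[OF V])
  have "openin (top_of_set half_plane) U" using assms by (simp add: local_parametrisation_def)
  from openin_subset[OF this] have U: "U \<subseteq> half_plane" by simp
  have ts: "topspace (subtopology S V) = V" using VS by (rule topspace_subtopology_subset)
  obtain \<phi> where \<phi>: "homeomorphic_maps (top_of_set U) (subtopology S V) \<psi> \<phi>"
    using assms unfolding local_parametrisation_def homeomorphic_map_maps by blast
  have inv: "\<phi> (\<psi> w) = w" "\<psi> w \<in> V" if "w \<in> U" for w
    using \<phi> that ts unfolding homeomorphic_maps_def continuous_map_def by auto
  have inv2: "\<psi> (\<phi> p) = p" "\<phi> p \<in> U" if "p \<in> V" for p
    using \<phi> that ts unfolding homeomorphic_maps_def continuous_map_def by auto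
  show ?thesis
  proof (rule that[of \<phi>])
    show "continuous_map (top_of_set U) (subtopology S V) \<psi>" "continuous_map (subtopology S V) (top_of_set U) \<phi>"
      using \<phi> by (simp_all add: homeomorphic_maps_def)
    show "\<psi> ` U = V" "\<phi> ` V = U" using inv inv2 by (force simp: image_iff)+
  qed (use inv inv2 V VS U in auto)
qed

lemma interior_of_chart_open:
  assumes "local_parametrisation S U V \<psi>"
  shows "open (U \<inter> {w. 0 < Im w})"
proof -
  obtain Z where "open Z" "U = half_plane \<inter> Z"
    using assms unfolding local_parametrisation_def by (auto simp: openin_open)
  then have "U \<inter> {w. 0 < Im w} = Z \<inter> {w. 0 < Im w}" by (auto simp: half_plane_def)
  then show ?thesis using \<open>open Z\<close> open_halfspace_Im_gt by auto
qed

text \<open>Whether a point lies on the edge of the half-plane does not depend on the chart: a point that has a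
  plane disc as neighbourhood is not on the edge in any other chart, as the change of charts
  would map the disc onto an open subset of the plane inside the closed half-plane.\<close>

lemma disc_point_is_chart_interior:
  fixes B :: "complex set"
  assumes par: "local_parametrisation S U V \<psi>"
    and "open B" and g: "continuous_map (top_of_set B) S g" "inj_on g B" "g ` B \<subseteq> V"
    and z: "z \<in> B" "g z = \<psi> w" "w \<in> U"
  shows "0 < Im w"
proof -
  obtain \<phi> where \<phi>: "continuous_map (subtopology S V) (top_of_set U) \<phi>"
    "\<And>w. w \<in> U \<Longrightarrow> \<phi> (\<psi> w) = w" "\<And>p. p \<in> V \<Longrightarrow> \<psi> (\<phi> p) = p" "\<phi> ` V = U" "U \<subseteq> half_plane"
    using local_parametrisation_inverse[OF par] by metis
  have "continuous_map (top_of_set B) (subtopology S V) g"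
    using g by (auto simp: continuous_map_in_subtopology)
  then have "continuous_map (top_of_set B) (top_of_set U) (\<phi> \<circ> g)"
    using \<phi>(1) continuous_map_compose by blast
  then have cont: "continuous_on B (\<phi> \<circ> g)" and sub: "(\<phi> \<circ> g) ` B \<subseteq> half_plane"
    using \<phi>(5) by (auto simp: continuous_map_in_subtopology)
  have "inj_on (\<phi> \<circ> g) B"
  proof (rule inj_onI)
    fix x y assume xy: "x \<in> B" "y \<in> B" "(\<phi> \<circ> g) x = (\<phi> \<circ> g) y"
    then have "\<psi> (\<phi> (g x)) = \<psi> (\<phi> (g y))" by simp
    then have "g x = g y" using \<phi>(3) g(3) xy(1,2) by (simp add: image_subset_iff)
    then show "x = y" using g(2) xy(1,2) by (simp add: inj_on_eq_iff)
  qed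
  then have op: "open ((\<phi> \<circ> g) ` B)" by (rule invariance_of_domain[OF cont \<open>open B\<close>])
  have "w = (\<phi> \<circ> g) z" using z \<phi>(2) by simp
  then have "w \<in> (\<phi> \<circ> g) ` B" using z(1) by (rule image_eqI)
  then obtain e where e: "e > 0" "ball w e \<subseteq> half_plane"
    using op sub by (meson openE order_trans)
  have "w - Complex 0 (e / 2) \<in> ball w e" using e by (simp add: dist_norm complex_norm)
  then have "w - Complex 0 (e / 2) \<in> half_plane" using e by blast
  then show ?thesis using e by (simp add: half_plane_def)
qed

lemma chart_interior_disc:
  assumes par: "local_parametrisation S U V \<psi>" and N: "openin S N" "w \<in> U" "0 < Im w" "\<psi> w \<in> N"
  defines "B \<equiv> {v \<in> U. 0 < Im v \<and> \<psi> v \<in> N}"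
  shows "open B" "continuous_map (top_of_set B) S \<psi>" "inj_on \<psi> B" "w \<in> B"
proof -
  obtain \<phi> where \<psi>: "continuous_map (top_of_set U) (subtopology S V) \<psi>"
    "\<And>w. w \<in> U \<Longrightarrow> \<phi> (\<psi> w) = w" using local_parametrisation_inverse[OF par] by metis
  have c: "continuous_map (top_of_set U) S \<psi>"
    using \<psi>(1) continuous_map_into_fulltopology by blast
  have "openin (top_of_set U) {v \<in> topspace (top_of_set U). \<psi> v \<in> N}"
    using c N(1) by (rule openin_continuous_map_preimage)
  then obtain Z where Z: "open Z" "{v \<in> U. \<psi> v \<in> N} = U \<inter> Z"
    by (auto simp: openin_open)
  have "B = (U \<inter> {w. 0 < Im w}) \<inter> Z" using Z unfolding B_def by auto
  then show "open B" using interior_of_chart_open[OF par] Z by auto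
  show "continuous_map (top_of_set B) S \<psi>"
    by (rule continuous_map_from_subtopology_mono[OF c]) (auto simp: B_def)
  show "inj_on \<psi> B" using \<psi>(2) unfolding B_def inj_on_def by (metis mem_Collect_eq)
  show "w \<in> B" using N by (simp add: B_def)
qed

lemma chart_interior_not_boundary:
  assumes "local_parametrisation S U V \<psi>" "w \<in> U" "0 < Im w"
  shows "\<psi> w \<notin> surface_boundary S"
proof
  assume "\<psi> w \<in> surface_boundary S"
  then obtain U' V' \<psi>' z where p: "local_parametrisation S U' V' \<psi>'" "z \<in> U'" "Im z = 0" "\<psi>' z = \<psi> w"
    unfolding surface_boundary_def by blast
  obtain \<phi>' where V': "openin S V'" "\<psi>' ` U' = V'" using local_parametrisation_inverse[OF p(1)] by metis
  then have "\<psi> w \<in> V'" using p by (metis imageI)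
  note B = chart_interior_disc[OF assms(1) V'(1) assms(2,3) this]
  have "0 < Im z"
    by (rule disc_point_is_chart_interior[OF p(1) B(1,2,3) _ B(4) p(4)[symmetric] p(2)]) auto
  then show False using p by simp
qed


section \<open>Half-disc neighbourhoods of the asymptotic arc\<close>

text \<open>In a chart at \<open>\<gamma>' s\<close> all points of \<open>\<gamma>\<close> are on the edge of the half-plane, since they are boundary
  points of \<open>T\<close>. A subarc of \<open>\<gamma>'\<close> around \<open>s\<close> is therefore mapped injectively to the real line and covers an
  open interval. So a small closed half disc has its whole diameter on \<open>\<gamma>'\<close>, and its other points are interior
  points of the surface. In particular no other part of \<open>\<gamma>\<close>, and no finite boundary, comes near \<open>\<gamma>' s\<close>.\<close>

lemma half_disc_neighbourhood:
  fixes T :: "('a + complex \<times> real) topology"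
  assumes top: "topspace T = Inl ` A \<union> Inr ` path_image \<gamma>"
    and emb: "embedding_map (top_of_set (path_image \<gamma>)) T Inr"
    and bd: "Inr ` path_image \<gamma> \<subseteq> surface_boundary T"
    and \<gamma>': "arc \<gamma>'" "path_image \<gamma>' \<subseteq> path_image \<gamma>" and s: "0 < s" "s < 1"
  obtains N Q where "openin T N" "compactin T Q" "Inr (\<gamma>' s) \<in> N" "N \<subseteq> Q"
    "\<And>p. Inr p \<in> Q \<Longrightarrow> p \<in> path_image \<gamma>'"
    "\<And>a. Inl a \<in> Q \<Longrightarrow> \<exists>U V \<psi> w. local_parametrisation T U V \<psi> \<and> w \<in> U \<and> 0 < Im w \<and> \<psi> w = Inl a"
    "\<And>G. openin T G \<Longrightarrow> Inr (\<gamma>' s) \<in> G \<Longrightarrow> \<exists>a. Inl a \<in> G"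
proof -
  have sin: "\<gamma>' s \<in> path_image \<gamma>'" using s by (simp add: path_image_def)
  then have "Inr (\<gamma>' s) \<in> surface_boundary T" using \<gamma>'(2) bd by blast
  then obtain U V \<psi> z where par: "local_parametrisation T U V \<psi>" and z: "z \<in> U" "Im z = 0" "\<psi> z = Inr (\<gamma>' s)"
    unfolding surface_boundary_def by blast
  obtain \<phi> where \<psi>: "continuous_map (top_of_set U) (subtopology T V) \<psi>"
    and \<phi>: "continuous_map (subtopology T V) (top_of_set U) \<phi>"
    and inv: "\<And>w. w \<in> U \<Longrightarrow> \<phi> (\<psi> w) = w" "\<And>p. p \<in> V \<Longrightarrow> \<psi> (\<phi> p) = p"
    and im: "\<psi> ` U = V" "\<phi> ` V = U" and V: "V \<subseteq> topspace T" "openin T V" and U: "U \<subseteq> half_plane"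
    using local_parametrisation_inverse[OF par] by metis
  have \<psi>T: "continuous_map (top_of_set U) T \<psi>" using \<psi> continuous_map_into_fulltopology by blast
  have real: "Im w = 0" if "w \<in> U" "\<psi> w \<in> Inr ` path_image \<gamma>" for w
  proof -
    have "\<not> 0 < Im w" using chart_interior_not_boundary[OF par that(1)] that(2) bd by blast
    then show ?thesis using that(1) U by (auto simp: half_plane_def)
  qed

  \<comment> \<open>the diameter of a small half disc is contained in the arc\<close>
  have cInr: "continuous_map (top_of_set (path_image \<gamma>')) T Inr"
    by (rule continuous_map_from_subtopology_mono[OF _ \<gamma>'(2)])
       (use emb in \<open>unfold embedding_map_def, blast intro: homeomorphic_imp_continuous_map continuous_map_into_fulltopology\<close>)
  have "continuous_map (top_of_set {0..1}) (top_of_set (path_image \<gamma>')) \<gamma>'"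
    using \<gamma>'(1) by (auto simp: arc_def path_def path_image_def)
  then have c\<gamma>: "continuous_map (top_of_set {0..1}) T (Inr \<circ> \<gamma>')"
    using cInr continuous_map_compose by blast
  have "openin (top_of_set {0..1}) {x \<in> topspace (top_of_set {0..1}). (Inr \<circ> \<gamma>') x \<in> V}"
    by (rule openin_continuous_map_preimage[OF c\<gamma> V(2)])
  then obtain G where G: "open G" "{x \<in> {0..1}. Inr (\<gamma>' x) \<in> V} = {0..1} \<inter> G"
    by (auto simp: openin_open)
  define J where "J = {0<..<1} \<inter> G"
  have J: "open J" using G by (auto simp: J_def)
  have JV: "x \<in> {0..1}" "Inr (\<gamma>' x) \<in> V" if "x \<in> J" for x
  proof -
    have "x \<in> {0..1} \<inter> G" using that by (simp add: J_def)
    then show "x \<in> {0..1}" "Inr (\<gamma>' x) \<in> V" unfolding G(2)[symmetric] by simp_all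
  qed
  then have JI: "J \<subseteq> {0..1}" by blast
  let ?k = "\<lambda>x. \<phi> (Inr (\<gamma>' x))"
  have J\<gamma>: "Inr (\<gamma>' x) \<in> Inr ` path_image \<gamma>" if "x \<in> J" for x
  proof -
    have "\<gamma>' x \<in> path_image \<gamma>'" using JV(1)[OF that] unfolding path_image_def by (rule imageI)
    then show ?thesis using \<gamma>'(2) by blast
  qed
  have kU: "?k x \<in> U" "\<psi> (?k x) = Inr (\<gamma>' x)" "Im (?k x) = 0" if "x \<in> J" for x
  proof -
    show *: "?k x \<in> U" "\<psi> (?k x) = Inr (\<gamma>' x)" using JV[OF that] im inv by auto
    show "Im (?k x) = 0" by (rule real[OF *(1)]) (unfold *(2), rule J\<gamma>[OF that])
  qed
  have "continuous_map (top_of_set J) (subtopology T V) (Inr \<circ> \<gamma>')"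
    using continuous_map_from_subtopology_mono[OF c\<gamma> JI] JV(2) by (auto simp: continuous_map_in_subtopology)
  then have "continuous_map (top_of_set J) (top_of_set U) (\<phi> \<circ> (Inr \<circ> \<gamma>'))"
    using \<phi> continuous_map_compose by blast
  then have "continuous_on J ?k" by (simp add: continuous_map_in_subtopology o_def)
  then have "continuous_on J (\<lambda>x. Re (?k x))" by (intro continuous_intros)
  moreover have "inj_on (\<lambda>x. Re (?k x)) J"
  proof (rule inj_onI)
    fix x y assume xy: "x \<in> J" "y \<in> J" "Re (?k x) = Re (?k y)"
    then have "?k x = ?k y" using kU by (simp add: complex_eq_iff)
    then have "\<gamma>' x = \<gamma>' y" using kU(2) xy by (metis sum.inject(2))
    then show "x = y" using \<gamma>'(1) JV xy unfolding arc_def inj_on_def by blast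
  qed
  ultimately have "open ((\<lambda>x. Re (?k x)) ` J)" using J invariance_of_domain by blast
  moreover have "Re z \<in> (\<lambda>x. Re (?k x)) ` J"
  proof
    have "\<psi> z \<in> V" using z(1) im(1) by (metis imageI)
    then have "s \<in> {x \<in> {0..1}. Inr (\<gamma>' x) \<in> V}" using s z(3) by simp
    then show "s \<in> J" unfolding G(2) using s by (simp add: J_def)
    show "Re z = Re (?k s)" using inv(1)[OF z(1)] z(3) by simp
  qed
  ultimately obtain e1 where e1: "e1 > 0" "ball (Re z) e1 \<subseteq> (\<lambda>x. Re (?k x)) ` J" by (auto elim: openE)
  have diam: "\<psi> w \<in> Inr ` path_image \<gamma>'" if "w \<in> U" "Im w = 0" "dist w z < e1" for w
  proof -
    have "dist (Re w) (Re z) \<le> dist w z" using abs_Re_le_cmod[of "w - z"] by (simp add: dist_norm)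
    then have "Re w \<in> (\<lambda>x. Re (?k x)) ` J" using e1 that by (auto simp: dist_commute subset_eq)
    then obtain x where x: "x \<in> J" "Re w = Re (?k x)" by blast
    then have "w = ?k x" using kU(3) that by (simp add: complex_eq_iff)
    then show ?thesis using kU(2) JV x by (auto simp: path_image_def)
  qed
  obtain W where W: "open W" "U = half_plane \<inter> W"
    using par unfolding local_parametrisation_def by (auto simp: openin_open)
  obtain e2 where e2: "e2 > 0" "ball z e2 \<subseteq> W" using W z by (auto elim: openE)
  define e where "e = min e1 e2 / 2"
  have e: "0 < e" "e < e1" "e < e2" using e1 e2 by (auto simp: e_def)
  define D where "D = half_plane \<inter> cball z e"
  have DU: "D \<subseteq> U" using e e2 W by (auto simp: D_def)
  define N where "N = \<psi> ` (half_plane \<inter> ball z e)"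
  have NU: "half_plane \<inter> ball z e \<subseteq> U" using DU by (auto simp: D_def)
  have inQ: "(Im w = 0 \<and> \<psi> w \<in> Inr ` path_image \<gamma>') \<or> (0 < Im w \<and> \<psi> w \<in> Inl ` A)" if "w \<in> D" for w
  proof (cases "Im w = 0")
    case True
    then show ?thesis using diam[of w] that DU e by (auto simp: D_def dist_commute)
  next
    case False
    then have "0 < Im w" using that by (auto simp: D_def half_plane_def)
    then have "\<psi> w \<notin> Inr ` path_image \<gamma>" using real that DU by auto
    moreover have "\<psi> w \<in> topspace T" using that DU im V by auto
    ultimately show ?thesis using \<open>0 < Im w\<close> top by auto
  qed
  show ?thesis
  proof (rule that[of N "\<psi> ` D"])
    have Neq: "N = {p \<in> topspace (subtopology T V). \<phi> p \<in> half_plane \<inter> ball z e}"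
    proof (intro equalityI subsetI)
      fix p assume "p \<in> N"
      then obtain w where w: "w \<in> half_plane \<inter> ball z e" "p = \<psi> w" unfolding N_def by blast
      then have "w \<in> U" using NU by blast
      then have "\<phi> p = w" "p \<in> V" using w(2) inv(1) im(1) by auto
      then show "p \<in> {p \<in> topspace (subtopology T V). \<phi> p \<in> half_plane \<inter> ball z e}"
        using w(1) V(1) by auto
    next
      fix p assume p: "p \<in> {p \<in> topspace (subtopology T V). \<phi> p \<in> half_plane \<inter> ball z e}"
      then have "p = \<psi> (\<phi> p)" using inv(2) by simp
      then show "p \<in> N" unfolding N_def using p by blast
    qed
    have "openin (top_of_set U) (half_plane \<inter> ball z e)"
      using NU U by (auto simp: openin_open intro!: exI[of _ "ball z e"])
    then have "openin (subtopology T V) N"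
      unfolding Neq by (rule openin_continuous_map_preimage[OF \<phi>])
    then show "openin T N" using V(2) openin_trans_full by blast
    have "closed half_plane" unfolding half_plane_def by (simp add: closed_halfspace_Im_ge)
    then have "compact D" unfolding D_def by (simp add: closed_Int_compact)
    then show "compactin T (\<psi> ` D)"
      by (intro image_compactin[OF _ \<psi>T]) (use DU in \<open>simp add: compactin_subtopology\<close>)
    show "Inr (\<gamma>' s) \<in> N" unfolding N_def using z e U by (intro image_eqI[of _ _ z]) auto
    show "N \<subseteq> \<psi> ` D" unfolding N_def D_def by (intro image_mono) auto
    show "p \<in> path_image \<gamma>'" if "Inr p \<in> \<psi> ` D" for p using that inQ by force
    show "\<exists>U V \<psi> w. local_parametrisation T U V \<psi> \<and> w \<in> U \<and> 0 < Im w \<and> \<psi> w = Inl a"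
      if a: "Inl a \<in> \<psi> ` D" for a
    proof -
      obtain w where w: "w \<in> D" "\<psi> w = Inl a" using a by (metis imageE)
      then have "0 < Im w" using inQ[OF w(1)] by auto
      then show ?thesis using par w DU by blast
    qed
    show "\<exists>a. Inl a \<in> G" if G: "openin T G" "Inr (\<gamma>' s) \<in> G" for G
    proof -
      have "openin (top_of_set U) {v \<in> topspace (top_of_set U). \<psi> v \<in> G}"
        using \<psi>T G(1) by (rule openin_continuous_map_preimage)
      then obtain H where H: "open H" "{v \<in> U. \<psi> v \<in> G} = U \<inter> H" by (auto simp: openin_open)
      moreover have "z \<in> {v \<in> U. \<psi> v \<in> G}" using z G by simp
      ultimately have "z \<in> H" by blast
      then obtain d where d: "d > 0" "ball z d \<subseteq> H" using H by (auto elim: openE)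
      define w where "w = z + Complex 0 (min d e / 2)"
      have "dist z w = min d e / 2" "Im w = min d e / 2"
        using d e z by (auto simp: w_def dist_norm complex_norm)
      then have w: "w \<in> D" "w \<in> H" "0 < Im w" using d e z U by (auto simp: D_def half_plane_def)
      then have "\<psi> w \<in> G" using H DU by blast
      then show ?thesis using inQ[OF w(1)] w(3) by auto
    qed
  qed
qed


section \<open>The theorem\<close>

theorem theorem2p1:
  fixes \<gamma> \<gamma>' :: "real \<Rightarrow> complex \<times> real" and q :: complex and t0 :: real
  assumes "arc \<gamma>" and "path_image \<gamma> \<subseteq> H2R_infinity"
    and "q \<in> sphere 0 1"
    and "arc \<gamma>'" and "path_image \<gamma>' \<subseteq> path_image \<gamma>"
    and "path_image \<gamma>' \<inter> vertical_line q \<noteq> {}"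
    and "{pathstart \<gamma>', pathfinish \<gamma>'} \<inter> vertical_line q = {}"
    and "one_side_of_vertical_line q (path_image \<gamma>')"
    and "path_image \<gamma>' \<subseteq> sphere 0 1 \<times> {t0<..<pi + t0}"
  shows "\<not> (\<exists>(S :: 'a topology) (X :: 'a \<Rightarrow> complex \<times> real).
            properly_immersed_minimal_surface S X \<and>
            asymptotic_boundary (X ` topspace S) = path_image \<gamma> \<and>
            continuous_surface_with_boundary S X (path_image \<gamma>))"
proof
  assume "\<exists>(S :: 'a topology) (X :: 'a \<Rightarrow> complex \<times> real).
            properly_immersed_minimal_surface S X \<and>
            asymptotic_boundary (X ` topspace S) = path_image \<gamma> \<and>
            continuous_surface_with_boundary S X (path_image \<gamma>)"
  then obtain S :: "'a topology" and X :: "'a \<Rightarrow> complex \<times> real"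
    where surf: "properly_immersed_minimal_surface S X"
      and "continuous_surface_with_boundary S X (path_image \<gamma>)" by blast
  then obtain T :: "('a + complex \<times> real) topology" where
    T: "topspace T = Inl ` topspace S \<union> Inr ` path_image \<gamma>"
      "embedding_map S T Inl" "embedding_map (top_of_set (path_image \<gamma>)) T Inr"
      "surface_with_boundary T" "Inr ` path_image \<gamma> \<subseteq> surface_boundary T"
      "continuous_map T (top_of_set H2R_closed) (case_sum X (\<lambda>p. p))"
    unfolding continuous_surface_with_boundary_def by blast
  define Y where "Y = case_sum X (\<lambda>p. p)"
  have Y: "continuous_map T euclidean Y" "Y \<in> topspace T \<rightarrow> H2R_closed"
    using T(6) unfolding Y_def continuous_map_in_subtopology by auto
  have XH: "X a \<in> H2R" if "a \<in> topspace S" for a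
    using surf that unfolding properly_immersed_minimal_surface_def continuous_map_in_subtopology by auto
  have nX: "norm (fst (X a)) < 1" if "Inl a \<in> topspace T" for a
    using XH[of a] that T(1) by (auto simp: H2R_def)
  have nq: "norm q = 1" using assms(3) by simp
  have haus: "Hausdorff_space T" using T(4) by (simp add: surface_with_boundary_def)

  define L where "L = path_image \<gamma>' \<inter> vertical_line q"
  define E :: "('a + complex \<times> real) set" where "E = Inr ` L"
  have "closed (vertical_line q)" unfolding vertical_line_def by (intro closed_Times) auto
  then have "compact L" unfolding L_def using assms(4) by (intro compact_Int_closed compact_arc_image)
  have cInr: "continuous_map (top_of_set (path_image \<gamma>)) T Inr"
    using T(3) unfolding embedding_map_def
    using continuous_map_into_fulltopology homeomorphic_imp_continuous_map by blast
  have "compactin T E" unfolding E_def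
    by (rule image_compactin[OF _ cInr]) (use \<open>compact L\<close> assms(5) in \<open>auto simp: compactin_subtopology L_def\<close>)

  \<comment> \<open>a compact neighbourhood of the part of the arc over \<open>q\<close>\<close>
  define good where "good = (\<lambda>N Q. openin T N \<and> compactin T Q \<and> N \<subseteq> Q \<and>
      (\<forall>p. Inr p \<in> Q \<longrightarrow> p \<in> path_image \<gamma>') \<and>
      (\<forall>a. Inl a \<in> Q \<longrightarrow> (\<exists>U V \<psi> w. local_parametrisation T U V \<psi> \<and> w \<in> U \<and> 0 < Im w \<and> \<psi> w = Inl a)))"
  have local: "\<exists>N Q. good N Q \<and> e \<in> N \<and> (\<forall>G. openin T G \<longrightarrow> e \<in> G \<longrightarrow> (\<exists>a. Inl a \<in> G))" if eE: "e \<in> E" for e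
  proof -
    obtain x where x: "e = Inr x" "x \<in> path_image \<gamma>'" "x \<in> vertical_line q"
      using eE unfolding E_def L_def by blast
    then obtain s where s: "s \<in> {0..1}" "e = Inr (\<gamma>' s)" "\<gamma>' s \<in> vertical_line q"
      unfolding path_image_def by blast
    have "s \<noteq> 0" "s \<noteq> 1"
      using s(3) assms(7) by (auto simp: pathstart_def pathfinish_def)
    then have "0 < s" "s < 1" using s(1) by auto
    then show ?thesis
      by (rule half_disc_neighbourhood[OF T(1,3,5) assms(4,5)]) (unfold good_def s(2), blast)
  qed
  then obtain NN QQ where NQ: "\<And>e. e \<in> E \<Longrightarrow> good (NN e) (QQ e) \<and> e \<in> NN e" by metis
  have "\<exists>F. finite F \<and> F \<subseteq> NN ` E \<and> E \<subseteq> \<Union>F"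
    using \<open>compactin T E\<close> unfolding compactin_def
    by (elim conjE allE[of _ "NN ` E"]) (use NQ in \<open>auto simp: good_def\<close>)
  then obtain E0 where E0: "finite E0" "E0 \<subseteq> E" "E \<subseteq> (\<Union>e\<in>E0. NN e)"
    by (metis finite_subset_image)
  define N where "N = (\<Union>e\<in>E0. NN e)"
  define Q where "Q = (\<Union>e\<in>E0. QQ e)"
  have N: "openin T N" "N \<subseteq> Q" "E \<subseteq> N"
    using NQ E0 unfolding N_def Q_def good_def by (blast intro: openin_Union)+
  have Q: "compactin T Q"
    unfolding Q_def using E0 NQ by (intro compactin_Union) (auto simp: good_def)
  have QInr: "p \<in> path_image \<gamma>'" if "Inr p \<in> Q" for p
    using that NQ E0 unfolding Q_def good_def by blast
  have QInl: "\<exists>U V \<psi> w. local_parametrisation T U V \<psi> \<and> w \<in> U \<and> 0 < Im w \<and> \<psi> w = Inl a" if "Inl a \<in> Q" for a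
    using that NQ E0 unfolding Q_def good_def by blast
  have QT: "Q \<subseteq> topspace T" using Q compactin_subset_topspace by blast

  define c where "c = t0 + pi / 2"
  obtain \<epsilon> where \<epsilon>: "0 < \<epsilon>" "\<epsilon> < pi / 2" "\<And>p. p \<in> path_image \<gamma>' \<Longrightarrow> \<bar>snd p - c\<bar> < pi / 2 - \<epsilon>"
  proof -
    have "compact ((\<lambda>p. \<bar>snd p - c\<bar>) ` path_image \<gamma>')"
      using assms(4) by (intro compact_continuous_image compact_arc_image continuous_intros)
    moreover have "(\<lambda>p. \<bar>snd p - c\<bar>) ` path_image \<gamma>' \<noteq> {}" using assms(6) by blast
    ultimately obtain p0 where p0: "p0 \<in> path_image \<gamma>'"
      "\<And>p. p \<in> path_image \<gamma>' \<Longrightarrow> \<bar>snd p - c\<bar> \<le> \<bar>snd p0 - c\<bar>"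
      using compact_attains_sup[of "(\<lambda>p. \<bar>snd p - c\<bar>) ` path_image \<gamma>'"] by blast
    have "t0 < snd p0" "snd p0 < pi + t0" using p0(1) assms(9) by auto
    then have "\<bar>snd p0 - c\<bar> < pi / 2" unfolding c_def by linarith
    show ?thesis
    proof (rule that[of "(pi / 2 - \<bar>snd p0 - c\<bar>) / 2"])
      show "\<bar>snd p - c\<bar> < pi / 2 - (pi / 2 - \<bar>snd p0 - c\<bar>) / 2" if "p \<in> path_image \<gamma>'" for p
        using p0(2)[OF that] \<open>\<bar>snd p0 - c\<bar> < pi / 2\<close> by argo
    qed (use \<open>\<bar>snd p0 - c\<bar> < pi / 2\<close> pi_gt_zero in argo)+
  qed

  \<comment> \<open>near \<open>q\<close>, the points of \<open>Q\<close> are interior to it and have heights in the smaller slab\<close>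
  define H where "H = N \<inter> {y \<in> topspace T. Y y \<in> {k. \<bar>snd k - c\<bar> < pi / 2 - \<epsilon>}}"
  have "open {k :: complex \<times> real. \<bar>snd k - c\<bar> < pi / 2 - \<epsilon>}"
    by (intro open_Collect_less continuous_intros)
  then have H: "openin T H" unfolding H_def
    by (intro openin_Int N openin_continuous_map_preimage[OF Y(1)]) auto
  have EH: "y \<in> H" if y: "y \<in> Q" "fst (Y y) = q" for y
  proof -
    have "y \<notin> Inl ` topspace S" using nX y QT nq by (force simp: Y_def)
    then obtain p where p: "y = Inr p" using y QT T(1) by blast
    then have "p \<in> path_image \<gamma>'" using QInr y by blast
    then show ?thesis
      using y p N(3) \<epsilon>(3)[of p] QT by (auto simp: H_def E_def L_def Y_def vertical_line_def mem_Times_iff)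
  qed
  obtain r where r: "r > 0" "\<And>y. y \<in> Q \<Longrightarrow> dist (fst (Y y)) q < r \<Longrightarrow> y \<in> H"
  proof -
    have "compactin T (Q - H)"
      by (rule closed_compactin[OF Q _ closedin_diff[OF compactin_imp_closedin[OF haus Q] H]]) blast
    then have "compact (Y ` (Q - H))"
      using image_compactin[OF _ Y(1)] by auto
    then have "compact (fst ` Y ` (Q - H))"
      by (intro compact_continuous_image continuous_intros)
    moreover have "q \<notin> fst ` Y ` (Q - H)" using EH by blast
    ultimately obtain d where "d > 0" "\<And>x. x \<in> fst ` Y ` (Q - H) \<Longrightarrow> d \<le> dist q x"
      using separate_point_closed[OF compact_imp_closed] by metis
    then show ?thesis using that[of d] by (force simp: dist_commute)
  qed

  define K where "K = Y ` Q \<inter> (cball q (r / 2) \<times> UNIV)"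
  have "compact (Y ` Q)" using image_compactin[OF Q Y(1)] by auto
  then have K: "compact K" unfolding K_def by (intro compact_Int_closed closed_Times) auto
  have K': "K \<subseteq> H2R_closed" using Y(2) QT unfolding K_def by blast
  have KH: "\<exists>y\<in>H. k = Y y" if kK: "k \<in> K" for k
  proof -
    obtain y where y: "y \<in> Q" "k = Y y" using kK unfolding K_def by blast
    have "dist (fst k) q \<le> r / 2" using kK by (simp add: K_def mem_Times_iff dist_commute)
    then have "dist (fst (Y y)) q < r" using r(1) y(2) by simp
    then show ?thesis using r(2)[OF y(1)] y(2) by blast
  qed
  have height: "\<bar>snd k - c\<bar> \<le> pi / 2 - \<epsilon>" if "k \<in> K" for k
    using KH[OF that] by (auto simp: H_def)
  have free: "\<exists>a. norm a = 1 \<and> dist a q < \<delta> \<and> a \<notin> fst ` K" if \<delta>: "0 < \<delta>" for \<delta>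
  proof -
    obtain a where a: "norm a = 1" "dist a q < \<delta>" "a \<notin> fst ` path_image \<gamma>'"
      using one_side_free_point[OF assms(8) nq \<delta>] by blast
    have "a \<notin> fst ` K"
    proof
      assume "a \<in> fst ` K"
      then obtain y where y: "y \<in> Q" "a = fst (Y y)" by (auto simp: K_def)
      then have "y \<notin> Inl ` topspace S" using nX QT a(1) by (force simp: Y_def)
      then obtain p where "y = Inr p" using y QT T(1) by blast
      then show False using a(3) y QInr by (auto simp: Y_def)
    qed
    then show ?thesis using a by blast
  qed
  have approach: "\<exists>k\<in>K. norm (fst k) < 1 \<and> dist (fst k) q < \<delta>" if "0 < \<delta>" for \<delta>
  proof -
    obtain e where e: "e \<in> E" using assms(6) by (auto simp: E_def L_def)
    have eT: "e \<in> N" "e \<in> topspace T" "fst (Y e) = q"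
      using e N(3) N(2) QT by (auto simp: E_def L_def Y_def vertical_line_def)
    define G where "G = N \<inter> {y \<in> topspace T. Y y \<in> {k. dist (fst k) q < min \<delta> (r / 2)}}"
    have "open {k :: complex \<times> real. dist (fst k) q < min \<delta> (r / 2)}"
      by (intro open_Collect_less continuous_intros)
    then have "openin T G" unfolding G_def
      by (intro openin_Int N openin_continuous_map_preimage[OF Y(1)]) auto
    moreover have "e \<in> G" using eT that r by (simp add: G_def)
    ultimately obtain a where a: "Inl a \<in> G" using local[OF e] by blast
    then have "Y (Inl a) \<in> K" using N(2) by (auto simp: G_def K_def mem_Times_iff dist_commute)
    moreover have "norm (fst (Y (Inl a))) < 1" "dist (fst (Y (Inl a))) q < \<delta>"
      using a nX by (auto simp: G_def Y_def)
    ultimately show ?thesis by blast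
  qed
  have "0 < r / 2" using r by simp
  from sliding_barrier_contact[OF K K' nq this \<epsilon>(1,2) height free approach]
  obtain \<kappa> C p k where con: "1 < \<kappa>" "0 < C" "2 * \<kappa>\<^sup>2 < C\<^sup>2 * (\<kappa>\<^sup>2 - 1)" "norm p < 1"
    "k \<in> K" "norm (fst k) < 1" "dist (fst k) q < r / 2" "barrier \<kappa> c p k = C"
    "\<And>k'. k' \<in> K \<Longrightarrow> norm (fst k') < 1 \<Longrightarrow> C \<le> barrier \<kappa> c p k'" by blast
  obtain y where y: "y \<in> H" "k = Y y" using KH con(5) by blast
  have yN: "y \<in> N" "y \<in> topspace T" using y by (auto simp: H_def)
  have "y \<notin> Inr ` path_image \<gamma>"
    using y con(6) assms(2) by (auto simp: Y_def H2R_infinity_def)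
  then obtain a where a: "y = Inl a" "a \<in> topspace S" using yN T(1) by blast
  obtain U V \<psi> where par: "local_parametrisation S U V \<psi>" "a \<in> V" "minimal_parametrised U (X \<circ> \<psi>)"
    using surf a(2) unfolding properly_immersed_minimal_surface_def by blast
  obtain \<phi> where \<psi>: "continuous_map (top_of_set U) (subtopology S V) \<psi>" "\<psi> ` U = V" "openin S V"
    by (rule local_parametrisation_inverse[OF par(1)])
  obtain z where z: "z \<in> U" "\<psi> z = a" using par(2) \<psi>(2) by blast

  \<comment> \<open>the chart of \<open>S\<close> may differ from the chart of \<open>T\<close> in which \<open>a\<close> is known to be interior\<close>
  have hom: "homeomorphic_map S (subtopology T (Inl ` topspace S)) Inl"
    using T(2) by (simp add: embedding_map_def)
  have "0 < Im z"
  proof -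
    obtain U' V' \<psi>' w where w: "local_parametrisation T U' V' \<psi>'" "w \<in> U'" "0 < Im w" "\<psi>' w = Inl a"
      using QInl[of a] yN N(2) a by blast
    have "openin (subtopology T (Inl ` topspace S)) (Inl ` V)"
      using hom \<psi>(3) homeomorphic_imp_open_map open_map_def by blast
    then obtain V2 where V2: "openin T V2" "Inl ` V = V2 \<inter> Inl ` topspace S"
      by (auto simp: openin_subtopology)
    have "\<psi>' w \<in> V2" using w(4) par(2) V2(2) by auto
    note B = chart_interior_disc[OF w(1) V2(1) w(2,3) this]
    define B where "B = {v \<in> U'. 0 < Im v \<and> \<psi>' v \<in> V2}"
    note B = B[folded B_def]
    have "\<psi>' v \<in> topspace T" if "v \<in> B" for v
      using B(2) that by (auto simp: continuous_map_def)
    moreover have "\<psi>' v \<notin> Inr ` path_image \<gamma>" if "v \<in> B" for v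
      using chart_interior_not_boundary[OF w(1)] T(5) that by (auto simp: B_def)
    ultimately have BV: "\<psi>' v \<in> Inl ` V" if "v \<in> B" for v
      using that T(1) V2(2) by (auto simp: B_def)
    obtain inl' where inl': "homeomorphic_maps S (subtopology T (Inl ` topspace S)) Inl inl'"
      using hom homeomorphic_map_maps by blast
    have inl'1: "inl' (Inl b) = b" if "b \<in> topspace S" for b
      using inl' that by (simp add: homeomorphic_maps_def)
    have VS: "V \<subseteq> topspace S" using openin_subset[OF \<psi>(3)] .
    have "continuous_map (top_of_set B) (subtopology T (Inl ` topspace S)) \<psi>'"
      using B(2) BV VS by (auto simp: continuous_map_in_subtopology)
    then have "continuous_map (top_of_set B) S (inl' \<circ> \<psi>')"
      using inl' continuous_map_compose unfolding homeomorphic_maps_def by blast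
    moreover have Bv: "\<exists>b\<in>V. \<psi>' v = Inl b \<and> (inl' \<circ> \<psi>') v = b" if "v \<in> B" for v
      using BV[OF that] inl'1 VS by auto
    then have "inj_on (inl' \<circ> \<psi>') B"
      using B(3) unfolding inj_on_def by metis
    moreover have "(inl' \<circ> \<psi>') ` B \<subseteq> V" using Bv by blast
    moreover have "(inl' \<circ> \<psi>') w = \<psi> z" using w(4) inl'1 a(2) z(2) by simp
    ultimately show ?thesis
      using disc_point_is_chart_interior[OF par(1) B(1) _ _ _ B(4) _ z(1)] by blast
  qed

  obtain W F where F: "open W" "U \<subseteq> W" "C2_on F W" "\<And>z. z \<in> U \<Longrightarrow> F z = (X \<circ> \<psi>) z"
    "\<And>z. z \<in> U \<Longrightarrow> inj (frechet_derivative F (at z))"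
    "\<And>z N. z \<in> U \<Longrightarrow> unit_normal F z N \<Longrightarrow> mean_curvature F z N = 0"
    using par(3) unfolding minimal_parametrised_def by blast
  have Fz: "F z = k" using F(4)[OF z(1)] z(2) y(2) a(1) by (simp add: Y_def)
  \<comment> \<open>nearby points of the surface are still in \<open>K\<close>, so the barrier has a local minimum on it\<close>
  define G where "G = H \<inter> {y \<in> topspace T. Y y \<in> {k. dist (fst k) q < r / 2}}"
  have "open {k :: complex \<times> real. dist (fst k) q < r / 2}"
    by (intro open_Collect_less continuous_intros)
  then have "openin T G" unfolding G_def
    by (intro openin_Int H openin_continuous_map_preimage[OF Y(1)]) auto
  have "continuous_map (top_of_set U) S \<psi>" using \<psi>(1) continuous_map_into_fulltopology by blast
  moreover have "continuous_map S T Inl"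
    using hom continuous_map_into_fulltopology homeomorphic_imp_continuous_map by blast
  ultimately have "continuous_map (top_of_set U) T (Inl \<circ> \<psi>)" by (rule continuous_map_compose)
  then have "openin (top_of_set U) {v \<in> topspace (top_of_set U). (Inl \<circ> \<psi>) v \<in> G}"
    using \<open>openin T G\<close> by (rule openin_continuous_map_preimage)
  then obtain D where D: "open D" "{v \<in> U. Inl (\<psi> v) \<in> G} = U \<inter> D" by (auto simp: openin_open)
  have "Inl (\<psi> z) \<in> G" using y a z con(7) yN by (simp add: G_def)
  then have "z \<in> D" using D(2) z(1) by blast
  have "eventually (\<lambda>v. v \<in> (U \<inter> {w. 0 < Im w}) \<inter> D) (nhds z)"
    by (rule eventually_nhds_in_open[OF open_Int[OF interior_of_chart_open[OF par(1)] D(1)]])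
       (use \<open>z \<in> D\<close> z(1) \<open>0 < Im z\<close> in simp)
  then have "eventually (\<lambda>v. C \<le> barrier \<kappa> c p (F v)) (nhds z)"
  proof (rule eventually_mono)
    fix v assume v: "v \<in> (U \<inter> {w. 0 < Im w}) \<inter> D"
    then have vG: "Inl (\<psi> v) \<in> G" using D(2) by blast
    have "F v = Y (Inl (\<psi> v))" using F(4) v by (simp add: Y_def)
    moreover have "Y (Inl (\<psi> v)) \<in> K"
      using vG N(2) by (auto simp: G_def H_def K_def mem_Times_iff dist_commute)
    moreover have "norm (fst (Y (Inl (\<psi> v)))) < 1"
      using vG nX by (auto simp: G_def Y_def)
    ultimately show "C \<le> barrier \<kappa> c p (F v)" using con(9) by simp
  qed
  moreover have "F z \<in> H2R" using Fz con(6) by (simp add: H2R_def mem_Times_iff)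
  moreover have "barrier \<kappa> c p (F z) = C" using Fz con(8) by simp
  ultimately show False
    using no_interior_contact[OF F(3,1)] F(2,5,6) z(1) con(1-4) by blast
qed

end
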